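(* In the setting described in the context, assume conditions (L1)–(L4) hold and let $\mathcal A_1,\mathcal A_2$ be the sets defined there. Let $h_1,h_2$ be two positive (measurable) functions such that $$\int_{[T,2T]\cap\mathcal A_j}\frac{\Delta^2(x)}{x^{2\sigma_0+1}}\,dx\ll h_j(T)\qquad (j=1,2).$$ Then, as $\delta\to0^+$, $$\int_1^\infty\frac{\mu(\mathcal A_j\cap[x,2x])\,h_j(x)}{x^{2+\delta}}\,dx=\Omega\left(\frac1\delta\right)\qquad\text{for } j=1,2.$$
   Context: Let $\{a_n\}_{n\ge1}$ be a sequence of real numbers and $D(s)=\sum_{n\ge1}a_nn^{-s}$. Suppose there are real numbers $0<\sigma_1<\sigma_2$ such that $D(s)$ converges absolutely for $\Re(s)>\sigma_2$ and can be meromorphically continued to $\Re(s)>\sigma_1$ with only finitely many poles $\rho$ there, all with $\sigma_1<\Re(\rho)\le\sigma_2$; let $\mathcal P$ be the set of these poles and $\mathcal M(x)=\sum_{\rho\in\mathcal P}\mathrm{Res}_{s=\rho}\left(\frac{D(s)x^s}{s}\right)$. For $x\ge1$ let $\Delta(x)=\sum^*_{n\le x}a_n-\mathcal M(x)$, where $\sum^*_{n\le x}a_n=\sum_{n\le x}a_n$ if $x\notin\mathbb N$ and $\sum_{n\le x}a_n-\frac12a_x$ if $x\in\mathbb N$. Let $A(s)=\int_1^\infty\Delta(x)x^{-s-1}\,dx$; $A$ also denotes the analytic continuation of this function wherever it exists. Conditions: there is a real number $\sigma_0$ with $0<\sigma_0<\sigma_1$ such that (L1) there exists a real $t_0\ne0$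 with $\lambda:=\limsup_{\sigma\searrow\sigma_0}(\sigma-\sigma_0)|A(\sigma+it_0)|>0$ ($\lambda$ is a finite number); (L2) $l_s:=\limsup_{\sigma\searrow\sigma_0}(\sigma-\sigma_0)A(\sigma)<\infty$ and $l_i:=\liminf_{\sigma\searrow\sigma_0}(\sigma-\sigma_0)A(\sigma)>-\infty$; (L3) $l_i+\lambda>0$ and $l_s-\lambda<0$; (L4) $A(s)$ can be analytically continued to a region containing the half-line $\{\sigma\in\mathbb R:\sigma>\sigma_0\}$. For a fixed $\epsilon$ with $0<\epsilon<\min(l_i+\lambda,\lambda-l_s)$ put $\mathcal A_1=\{x\in[1,\infty):\Delta(x)>(l_i+\lambda-\epsilon)x^{\sigma_0}\}$ and $\mathcal A_2=\{x\in[1,\infty):\Delta(x)<(l_s-\lambda+\epsilon)x^{\sigma_0}\}$. $\mu$ is Lebesgue measure on $\mathbb R$. $F(\delta)=\Omega(1/\delta)$ as $\delta\to0^+$ means $\limsup_{\delta\to0^+}\delta|F(\delta)|>0$. *)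

theory Defs
  imports "HOL-Complex_Analysis.Complex_Analysis" "HOL-Library.Landau_Symbols"
begin

(* Only the values a 1, a 2, ... of a sequence a :: nat => real are used. *)

definition dirichlet_term :: "(nat \<Rightarrow> real) \<Rightarrow> complex \<Rightarrow> nat \<Rightarrow> complex" where
  "dirichlet_term a s n = of_real (a n) * of_nat n powr (-s)"

definition starred_sum :: "(nat \<Rightarrow> real) \<Rightarrow> real \<Rightarrow> real" where
  "starred_sum a x =
     (\<Sum>n | 1 \<le> n \<and> real n \<le> x. a n) - (if x \<in> \<nat> then a (nat \<lfloor>x\<rfloor>) / 2 else 0)"

definition poles_right_of :: "(complex \<Rightarrow> complex) \<Rightarrow> real \<Rightarrow> complex set" where
  "poles_right_of D \<sigma>\<^sub>1 = {\<rho>. \<sigma>\<^sub>1 < Re \<rho> \<and> is_pole D \<rho>}"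

definition main_term :: "(complex \<Rightarrow> complex) \<Rightarrow> real \<Rightarrow> real \<Rightarrow> complex" where
  "main_term D \<sigma>\<^sub>1 x =
     (\<Sum>\<rho>\<in>poles_right_of D \<sigma>\<^sub>1. residue (\<lambda>s. D s * of_real x powr s / s) \<rho>)"

(* The Dirichlet coefficients are real, so the poles come in conjugate pairs and main_term is
   real-valued for x >= 1; Re only changes the type. *)
definition error_term ::
    "(nat \<Rightarrow> real) \<Rightarrow> (complex \<Rightarrow> complex) \<Rightarrow> real \<Rightarrow> real \<Rightarrow> real" where
  "error_term a D \<sigma>\<^sub>1 x = starred_sum a x - Re (main_term D \<sigma>\<^sub>1 x)"

definition error_mellin :: "(real \<Rightarrow> real) \<Rightarrow> complex \<Rightarrow> complex" where
  "error_mellin \<Delta> s = (CLINT x:{1..}|lebesgue. of_real (\<Delta> x) * of_real x powr (-s - 1))"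

(* A, on the region R, is the analytic continuation of f from the half-plane Re s > c.
   The region is taken inside the half-plane Re s > b.  This makes "the" continuation
   unambiguous: two continuations along paths that leave Re s > b may differ at the same point. *)
definition continues_in_half_plane ::
    "real \<Rightarrow> real \<Rightarrow> (complex \<Rightarrow> complex) \<Rightarrow> (complex \<Rightarrow> complex) \<Rightarrow> complex set \<Rightarrow> bool" where
  "continues_in_half_plane b c f A R \<longleftrightarrow>
     open R \<and> connected R \<and> {s. c < Re s} \<subseteq> R \<and> R \<subseteq> {s. b < Re s} \<and>
     A holomorphic_on R \<and> (\<forall>s. c < Re s \<longrightarrow> A s = f s)"

(* F(delta) = Omega(1/delta) as delta -> 0+ for nonnegative F, which may be infinite. This is
   the negation of F = o(1/delta), not the Omega of Landau_Symbols. *)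
definition omega_inverse_at_0 :: "(real \<Rightarrow> ennreal) \<Rightarrow> bool" where
  "omega_inverse_at_0 F \<longleftrightarrow> Limsup (at_right 0) (\<lambda>\<delta>. ennreal \<delta> * F \<delta>) > 0"

end

theory Submission
  imports Defs
begin

text \<open>
  The idea is Landau's. The Mellin transform of a function of constant sign has a singularity at the real
  point of its abscissa of convergence, and on each vertical line it is largest at the real point.
  Suppose that \<open>\<Delta>\<close> exceeded \<open>c x powr \<sigma>\<^sub>0\<close>, with \<open>c = l\<^sub>i + lam - \<epsilon>\<close>, only so little that the Mellin transform of
  the excess is \<open>o (1 / \<delta>)\<close> at \<open>\<sigma>\<^sub>0 + \<delta>\<close>. Up to this excess, \<open>c x powr \<sigma>\<^sub>0 - \<Delta> x\<close> is nonnegative, and its transform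
  \<open>c / (s - \<sigma>\<^sub>0) - A s\<close> continues to the half-line to the right of \<open>\<sigma>\<^sub>0\<close>. So its modulus at \<open>\<sigma> + i t\<^sub>0\<close>, which is
  \<open>lam / (\<sigma> - \<sigma>\<^sub>0)\<close> for suitable \<open>\<sigma>\<close> near \<open>\<sigma>\<^sub>0\<close>, is at most its value at \<open>\<sigma>\<close>, which is at most about
  \<open>(c - l\<^sub>i) / (\<sigma> - \<sigma>\<^sub>0)\<close>. This contradicts \<open>c - l\<^sub>i < lam\<close>. The argument is in \<open>mellin_excess_not_negligible\<close>, and
  Landau's theorem in \<open>landau_convergence\<close>.

  It remains to bound the excess by the quantity in the statement. It is at most the integral of \<open>\<Delta>\<close> over
  the set \<open>\<A>\<^sub>1\<close>. On a window \<open>{x..2 * x}\<close> a Cauchy-Schwarz argument bounds that integral by the mean square,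
  which is \<open>O (h\<^sub>1 x)\<close>, and the measure of \<open>\<A>\<^sub>1\<close> in the window; the average over \<open>x\<close> with respect to \<open>dx / x\<close> collects
  all windows (\<open>window_bound\<close>, \<open>excess_integral_bound\<close>, \<open>excess_set_omega\<close>). The second set is the first one for \<open>- \<Delta>\<close>.

  The Dirichlet series gives the growth and the measurability of \<open>\<Delta>\<close>, and these give the absolute
  convergence of \<open>A\<close> to the right of \<open>\<sigma>\<^sub>2\<close> and the local finiteness of all integrals.
\<close>

section \<open>Laplace transforms of nonnegative measures and Landau's theorem\<close>

text \<open>
  The Laplace transform of a measure is written with an exponent function \<open>L\<close> on the measure space,
  so that the choice of \<open>L\<close> as the logarithm turns Mellin transforms into Laplace transforms
  without a change of variables.
\<close>

definition laplace :: "'a measure \<Rightarrow> ('a \<Rightarrow> real) \<Rightarrow> complex \<Rightarrow> complex" where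
  "laplace N L s = (\<integral>x. exp (- s * of_real (L x)) \<partial>N)"

text \<open>
  These are the Taylor coefficients of the Laplace transform at \<open>z\<close>. For real \<open>z\<close> their signs
  alternate, because \<open>L\<close> is nonnegative; Landau's theorem lives on this.
\<close>

definition laplace_coeff :: "'a measure \<Rightarrow> ('a \<Rightarrow> real) \<Rightarrow> complex \<Rightarrow> nat \<Rightarrow> complex" where
  "laplace_coeff N L z n = (\<integral>x. of_real (- L x) ^ n / fact n * exp (- z * of_real (L x)) \<partial>N)"

lemma norm_exp_neg_mult_of_real: "norm (exp (- s * of_real l :: complex)) = exp (- Re s * l)"
  by simp

context
  fixes N :: "'a measure" and L :: "'a \<Rightarrow> real"
  assumes L_meas [measurable]: "L \<in> borel_measurable N" and L_nonneg: "AE x in N. 0 \<le> L x"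
begin

lemma integrable_exp_neg_mono:
  assumes "integrable N (\<lambda>x. exp (- \<alpha> * L x))" "\<alpha> \<le> \<beta>"
  shows "integrable N (\<lambda>x. exp (- \<beta> * L x))"
proof (rule Bochner_Integration.integrable_bound[OF assms(1)])
  show "AE x in N. norm (exp (- \<beta> * L x)) \<le> norm (exp (- \<alpha> * L x))"
    using L_nonneg by eventually_elim (use assms(2) in \<open>auto intro: mult_right_mono\<close>)
qed simp

text \<open>
  A nonnegative measure makes the transform on a vertical line largest at its real point. This
  is how \<open>\<sigma> + i t\<^sub>0\<close> is compared with \<open>\<sigma>\<close>.
\<close>

lemma norm_laplace_le: "norm (laplace N L s) \<le> Re (laplace N L (of_real (Re s)))"
proof -
  have "norm (laplace N L s) \<le> (\<integral>x. exp (- Re s * L x) \<partial>N)"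
    unfolding laplace_def norm_exp_neg_mult_of_real [symmetric] by (rule integral_norm_bound)
  also have "\<dots> = Re (laplace N L (of_real (Re s)))"
    unfolding laplace_def
    by (simp add: exp_of_real flip: of_real_mult of_real_minus)
  finally show ?thesis .
qed

text \<open>
  Expand \<open>exp (- s L) = exp (- z L) exp (- (s - z) L)\<close> and integrate termwise. The sum of the absolute
  values of the terms is \<open>exp (- (Re z - norm (s - z)) L)\<close>, which the integrable function \<open>exp (- \<alpha> L)\<close>
  dominates.
\<close>

lemma laplace_sums:
  assumes int: "integrable N (\<lambda>x. exp (- \<alpha> * L x))" and s: "norm (s - z) \<le> Re z - \<alpha>"
  shows "(\<lambda>n. laplace_coeff N L z n * (s - z) ^ n) sums laplace N L s"
proof -
  define r where "r = norm (s - z)"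
  define f where "f n x = of_real (- L x) ^ n / fact n * exp (- z * of_real (L x)) * (s - z) ^ n" for n x
  have [measurable]: "f n \<in> borel_measurable N" for n unfolding f_def by measurable
  have nf: "norm (f n x) = (r * L x) ^ n /\<^sub>R fact n * exp (- Re z * L x)" if "0 \<le> L x" for n x
    using that unfolding f_def r_def
    by (simp add: norm_mult norm_power norm_divide power_mult_distrib field_simps)
  have nfs: "(\<lambda>n. norm (f n x)) sums exp ((r - Re z) * L x)" if "0 \<le> L x" for x
    using sums_mult2[OF exp_converges[of "r * L x"], of "exp (- Re z * L x)"]
    by (simp add: nf that exp_add [symmetric] algebra_simps)
  have partial: "(\<Sum>n<m. norm (f n x)) \<le> exp (- \<alpha> * L x)" if "0 \<le> L x" for m x
  proof -
    have "(\<Sum>n<m. norm (f n x)) \<le> exp ((r - Re z) * L x)"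
      by (subst sums_unique[OF nfs[OF that]], rule sum_le_suminf)
         (use nfs[OF that] in \<open>auto simp: sums_iff\<close>)
    also have "\<dots> \<le> exp (- \<alpha> * L x)"
      using mult_right_mono[of "r - Re z" "- \<alpha>" "L x"] s that unfolding r_def by simp
    finally show ?thesis .
  qed
  have int_f: "integrable N (f n)" for n
  proof (rule Bochner_Integration.integrable_bound[OF int])
    show "AE x in N. norm (f n x) \<le> norm (exp (- \<alpha> * L x))"
      using L_nonneg
    proof eventually_elim
      case (elim x)
      have "norm (f n x) \<le> (\<Sum>k<Suc n. norm (f k x))" by (rule member_le_sum) auto
      with partial[OF elim, of "Suc n"] show ?case by simp
    qed
  qed simp
  have "(\<lambda>n. integral\<^sup>L N (f n)) sums (\<integral>x. (\<Sum>n. f n x) \<partial>N)"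
  proof (rule sums_integral[OF int_f])
    show "AE x in N. summable (\<lambda>n. norm (f n x))"
      using L_nonneg by eventually_elim (use nfs sums_iff in blast)
    show "summable (\<lambda>n. \<integral>x. norm (f n x) \<partial>N)"
    proof (rule summableI_nonneg_bounded)
      fix m
      have "(\<Sum>n<m. \<integral>x. norm (f n x) \<partial>N) = (\<integral>x. (\<Sum>n<m. norm (f n x)) \<partial>N)"
        using int_f by (simp add: Bochner_Integration.integral_sum)
      also have "\<dots> \<le> (\<integral>x. exp (- \<alpha> * L x) \<partial>N)"
        using int_f int L_nonneg by (intro integral_mono_AE) (auto elim!: eventually_mono dest: partial)
      finally show "(\<Sum>n<m. \<integral>x. norm (f n x) \<partial>N) \<le> (\<integral>x. exp (- \<alpha> * L x) \<partial>N)" .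
    qed simp
  qed
  moreover have "integral\<^sup>L N (f n) = laplace_coeff N L z n * (s - z) ^ n" for n
    unfolding f_def laplace_coeff_def by simp
  moreover have "(\<Sum>n. f n x) = exp (- s * of_real (L x))" for x
  proof -
    have "f n x = (- (s - z) * of_real (L x)) ^ n /\<^sub>R fact n * exp (- z * of_real (L x))" for n
    proof -
      have pw: "of_real (- L x) ^ n * (s - z) ^ n = (- (s - z) * of_real (L x)) ^ n"
        unfolding power_mult_distrib[symmetric]
        by (rule arg_cong[where f = "\<lambda>u. u ^ n"]) (simp add: algebra_simps)
      show ?thesis
        unfolding f_def pw[symmetric] by (simp add: scaleR_conv_of_real divide_inverse mult_ac)
    qed
    hence "(\<lambda>n. f n x) = (\<lambda>n. (- (s - z) * of_real (L x)) ^ n /\<^sub>R fact n * exp (- z * of_real (L x)))"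
      by (rule ext)
    hence "(\<lambda>n. f n x) sums (exp (- (s - z) * of_real (L x)) * exp (- z * of_real (L x)))"
      using sums_mult2[OF exp_converges[of "- (s - z) * of_real (L x)"], of "exp (- z * of_real (L x))"]
      by (simp only:)
    thus ?thesis by (simp add: sums_iff algebra_simps flip: exp_add)
  qed
  ultimately show ?thesis by (simp add: laplace_def)
qed

lemma laplace_holomorphic:
  assumes int: "\<And>\<sigma>. \<alpha> < \<sigma> \<Longrightarrow> integrable N (\<lambda>x. exp (- \<sigma> * L x))"
  shows "laplace N L holomorphic_on {s. \<alpha> < Re s}"
proof -
  have "\<exists>e>0. laplace N L holomorphic_on ball z e" if z: "\<alpha> < Re z" for z
  proof -
    define e where "e = (Re z - \<alpha>) / 2"
    have "laplace N L holomorphic_on ball z e"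
    proof (rule power_series_holomorphic)
      fix w assume "w \<in> ball z e"
      thus "(\<lambda>n. laplace_coeff N L z n * (w - z) ^ n) sums laplace N L w"
        using z by (intro laplace_sums[of "\<alpha> + e"] int) (auto simp: e_def dist_norm norm_minus_commute field_simps)
    qed
    thus ?thesis using z by (auto simp: e_def intro!: exI[of _ e])
  qed
  hence "laplace N L analytic_on {s. \<alpha> < Re s}"
    by (auto simp: analytic_on_def)
  thus ?thesis by (rule analytic_imp_holomorphic)
qed

text \<open>
  Landau's theorem: the Laplace transform of a nonnegative measure cannot be continued past the
  abscissa \<open>p\<close> of convergence along the real axis. If it could, then expand the continuation about a real
  point slightly to the right of \<open>p\<close>, in a disc that reaches beyond \<open>p\<close>. Its Taylor coefficients are those of
  the transform and have alternating signs, so at a real point to the left of \<open>p\<close> the series has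
  nonnegative terms, and monotone convergence turns its finite sum into the integral.

  The part of \<open>R\<close> in the half-plane of convergence may be disconnected; on a thin rectangle around a
  real segment the identity theorem still shows that \<open>F\<close> is the transform.
\<close>

theorem landau_convergence:
  assumes R: "open R" "F holomorphic_on R" "\<And>\<sigma>. a < \<sigma> \<Longrightarrow> of_real \<sigma> \<in> R"
    and int: "\<And>\<sigma>. b < \<sigma> \<Longrightarrow> integrable N (\<lambda>x. exp (- \<sigma> * L x))"
    and eq: "\<And>s. b < Re s \<Longrightarrow> F s = laplace N L s"
    and \<tau>: "a < \<tau>"
  shows "integrable N (\<lambda>x. exp (- \<tau> * L x))"
proof (rule ccontr)
  assume not_int: "\<not> ?thesis"
  define S where "S = {\<sigma>. integrable N (\<lambda>x. exp (- \<sigma> * L x))}"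
  define p where "p = Inf S"
  have \<tau>_less: "\<tau> < \<sigma>" if "\<sigma> \<in> S" for \<sigma>
    using not_int integrable_exp_neg_mono[of \<sigma> \<tau>] that by (force simp: S_def)
  have bS: "b + 1 \<in> S" using int[of "b + 1"] by (simp add: S_def algebra_simps)
  have bdd: "bdd_below S" using \<tau>_less by (intro bdd_belowI[of _ \<tau>]) (auto intro: less_imp_le)
  have p_le: "p \<le> b + 1" unfolding p_def using bS bdd by (rule cInf_lower)
  have \<tau>_le: "\<tau> \<le> p" unfolding p_def using bS \<tau>_less by (intro cInf_greatest) (auto intro: less_imp_le)
  have above: "\<sigma> \<in> S" if "p < \<sigma>" for \<sigma>
  proof -
    have "S \<noteq> {}" using bS by blast
    from cInf_lessD[OF this that[unfolded p_def]] obtain \<sigma>' where "\<sigma>' \<in> S" "\<sigma>' < \<sigma>" by blast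
    thus ?thesis using integrable_exp_neg_mono[of \<sigma>' \<sigma>] by (simp add: S_def)
  qed
  have hol: "laplace N L holomorphic_on {s. p < Re s}"
    using above by (intro laplace_holomorphic) (simp add: S_def)
  have "compact (of_real ` {p..b+2} :: complex set)"
    by (intro compact_continuous_image continuous_intros) auto
  moreover have "of_real ` {p..b+2} \<subseteq> R" using R(3) \<tau> \<tau>_le by auto
  ultimately obtain \<epsilon> where \<epsilon>: "\<epsilon> > 0" "(\<Union>x\<in>of_real ` {p..b+2}. ball x \<epsilon>) \<subseteq> R"
    using compact_subset_open_imp_ball_epsilon_subset R(1) by metis
  define \<eta> where "\<eta> = min (\<epsilon> / 2) (1 / 2)"
  have \<eta>: "0 < \<eta>" "\<eta> \<le> \<epsilon> / 2" "\<eta> \<le> 1 / 2" using \<epsilon>(1) by (auto simp: \<eta>_def)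
  \<comment> \<open>A rectangle inside \<open>R\<close> around the segment from \<open>p\<close> to \<open>b + 2\<close>, and its part to the right of \<open>p\<close>.\<close>
  define V where "V = box (Complex (p - \<eta>) (- \<eta>)) (Complex (b + 2) \<eta>)"
  define V' where "V' = box (Complex p (- \<eta>)) (Complex (b + 2) \<eta>)"
  have VR: "V \<subseteq> R"
  proof
    fix s assume s: "s \<in> V"
    define q where "q = max p (Re s)"
    have "norm (of_real q - s) \<le> \<bar>q - Re s\<bar> + \<bar>Im s\<bar>"
      using cmod_le[of "of_real q - s"] by simp
    also have "\<dots> < \<epsilon>" using s \<eta> unfolding V_def q_def in_box_complex_iff by auto
    finally have "s \<in> ball (of_real q) \<epsilon>" by (simp add: dist_norm)
    moreover have "q \<in> {p..b+2}" using s p_le unfolding V_def q_def in_box_complex_iff by auto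
    ultimately show "s \<in> R" using \<epsilon>(2) by blast
  qed
  have V'V: "V' \<subseteq> V" unfolding V_def V'_def using \<eta>(1) by (auto simp: in_box_complex_iff)
  have eq': "F s = laplace N L s" if "s \<in> V'" for s
  proof (rule analytic_continuation_open[where s = "V' \<inter> {s. b < Re s}" and s' = V' and f = F])
    show "open (V' \<inter> {s. b < Re s})" by (simp add: V'_def open_box open_halfspace_Re_gt open_Int)
    have "of_real (b + 3 / 2) \<in> V' \<inter> {s. b < Re s}"
      using \<eta>(1) p_le by (simp add: V'_def in_box_complex_iff)
    thus "V' \<inter> {s. b < Re s} \<noteq> {}" by blast
    show "connected V'" unfolding V'_def by (intro convex_connected convex_box)
    show "F holomorphic_on V'" using R(2) VR V'V by (meson holomorphic_on_subset order_trans)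
    show "laplace N L holomorphic_on V'"
      using hol by (rule holomorphic_on_subset) (auto simp: V'_def in_box_complex_iff)
  qed (use that eq in \<open>auto simp: V'_def open_box\<close>)
  \<comment> \<open>The disc about \<open>z\<close> of radius \<open>2 \<eta> / 3\<close> lies in \<open>V\<close> and contains \<open>z - \<eta> / 2\<close>, which is to the left of \<open>p\<close>; the smaller disc of radius \<open>\<eta> / 3\<close> lies in \<open>V'\<close>, where \<open>F\<close> is the transform.\<close>
  define z where "z = p + \<eta> / 3"
  define c where "c = laplace_coeff N L (of_real z)"
  define G where "G w = F (of_real z + w)" for w
  have ball_V: "of_real z + w \<in> V" if "norm w < 2 * \<eta> / 3" for w
    using that abs_Re_le_cmod[of w] abs_Im_le_cmod[of w] \<eta> p_le
    unfolding V_def z_def by (auto simp: in_box_complex_iff)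
  have ball_V': "of_real z + w \<in> V'" if "norm w < \<eta> / 3" for w
    using that abs_Re_le_cmod[of w] abs_Im_le_cmod[of w] \<eta> p_le
    unfolding V'_def z_def by (auto simp: in_box_complex_iff)
  have G_hol: "G holomorphic_on ball 0 (2 * \<eta> / 3)"
    unfolding G_def
  proof (rule holomorphic_on_compose_gen[of "\<lambda>w. of_real z + w" _ F R, unfolded o_def])
    show "(\<lambda>w. of_real z + w) ` ball 0 (2 * \<eta> / 3) \<subseteq> R"
    proof (rule image_subsetI)
      fix w :: complex assume "w \<in> ball 0 (2 * \<eta> / 3)"
      thus "of_real z + w \<in> R" using ball_V[of w] VR by auto
    qed
  qed (use R(2) in \<open>auto intro!: holomorphic_intros\<close>)
  have "G has_fps_expansion fps_expansion G 0"
    using G_hol \<eta>(1) by (intro has_fps_expansion_fps_expansion) auto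
  moreover have "G has_fps_expansion Abs_fps c"
  proof (rule has_fps_expansionI)
    have "eventually (\<lambda>w. w \<in> ball 0 (\<eta> / 6)) (nhds (0::complex))"
      using \<eta>(1) by (intro eventually_nhds_in_open) auto
    thus "\<forall>\<^sub>F w in nhds 0. (\<lambda>n. fps_nth (Abs_fps c) n * w ^ n) sums G w"
    proof eventually_elim
      case (elim w)
      have "p + \<eta> / 6 \<in> S" using above \<eta>(1) by simp
      hence "integrable N (\<lambda>x. exp (- (p + \<eta> / 6) * L x))" by (simp only: S_def mem_Collect_eq)
      from laplace_sums[OF this, of "of_real z + w" "of_real z"] elim \<eta>(1)
      show ?case using eq'[OF ball_V'[of w]] by (simp add: z_def G_def c_def)
    qed
  qed
  ultimately have "fps_expansion G 0 = Abs_fps c" by (rule fps_expansion_unique_complex)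
  hence coeffs: "(deriv ^^ n) G 0 / fact n = c n" for n
    by (simp add: fps_expansion_def fps_eq_iff)
  have "(\<lambda>n. c n * (- of_real (\<eta> / 2)) ^ n) sums G (- of_real (\<eta> / 2))"
    using holomorphic_power_series[OF G_hol, of "- of_real (\<eta> / 2)"] \<eta>(1)
    by (simp add: coeffs)
  hence summ: "summable (\<lambda>n. c n * (- of_real (\<eta> / 2)) ^ n)" by (rule sums_summable)
  \<comment> \<open>The terms at \<open>z - \<eta> / 2\<close>, which are nonnegative.\<close>
  define f where "f n x = (\<eta> / 2 * L x) ^ n / fact n * exp (- z * L x)" for n x
  have f_nonneg: "AE x in N. 0 \<le> f n x" for n
    using L_nonneg by eventually_elim (use \<eta>(1) in \<open>auto simp: f_def\<close>)
  have [measurable]: "f n \<in> borel_measurable N" for n unfolding f_def by measurable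
  have c_eq: "c n * (- of_real (\<eta> / 2)) ^ n = of_real (\<integral>x. f n x \<partial>N)" for n
  proof -
    have "c n * (- of_real (\<eta> / 2)) ^ n
        = (\<integral>x. of_real (- L x) ^ n / fact n * exp (- of_real z * of_real (L x)) * (- of_real (\<eta> / 2)) ^ n \<partial>N)"
      unfolding c_def laplace_coeff_def by simp
    also have "\<dots> = (\<integral>x. of_real (f n x) \<partial>N)"
    proof (rule arg_cong[where f = "integral\<^sup>L N"], rule ext)
      fix x
      have pw: "of_real (- L x) ^ n * (- of_real (\<eta> / 2)) ^ n = (of_real ((\<eta> / 2 * L x) ^ n) :: complex)"
        unfolding power_mult_distrib[symmetric] of_real_power
        by (rule arg_cong[where f = "\<lambda>u. u ^ n"]) simp
      have e: "exp (- of_real z * of_real (L x)) = (of_real (exp (- z * L x)) :: complex)"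
        by (simp flip: exp_of_real)
      have "of_real (- L x) ^ n / fact n * exp (- of_real z * of_real (L x)) * (- of_real (\<eta> / 2)) ^ n
          = of_real (- L x) ^ n * (- of_real (\<eta> / 2)) ^ n / fact n * exp (- of_real z * of_real (L x) :: complex)"
        by (simp only: divide_inverse mult_ac)
      also have "\<dots> = of_real (f n x)"
        unfolding pw e f_def by simp
      finally show "of_real (- L x) ^ n / fact n * exp (- of_real z * of_real (L x)) * (- of_real (\<eta> / 2)) ^ n
          = (of_real (f n x) :: complex)" .
    qed
    finally show ?thesis by simp
  qed
  have f_int: "integrable N (f n)" for n
  proof (rule Bochner_Integration.integrable_bound)
    \<comment> \<open>Since \<open>\<eta> / 2 = 3 * (\<eta> / 6)\<close>, the \<open>n\<close>-th term is at most \<open>3 ^ n\<close> times the exponential at \<open>z - \<eta> / 6 = p + \<eta> / 6\<close>.\<close>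
    have "p + \<eta> / 6 \<in> S" using above \<eta>(1) by simp
    thus "integrable N (\<lambda>x. 3 ^ n * exp (- (p + \<eta> / 6) * L x))"
      unfolding S_def mem_Collect_eq by (rule integrable_mult_right)
    show "AE x in N. norm (f n x) \<le> norm (3 ^ n * exp (- (p + \<eta> / 6) * L x))"
      using L_nonneg
    proof eventually_elim
      case (elim x)
      have "(\<eta> / 6 * L x) ^ n / fact n \<le> (\<Sum>k. (\<eta> / 6 * L x) ^ k /\<^sub>R fact k)"
        using sum_le_suminf[OF summable_exp_generic, of "{n}" "\<eta> / 6 * L x"] elim \<eta>(1)
        by (simp add: field_simps)
      hence "(\<eta> / 6 * L x) ^ n / fact n \<le> exp (\<eta> / 6 * L x)" by (simp add: exp_def)
      hence "3 ^ n * ((\<eta> / 6 * L x) ^ n / fact n) * exp (- z * L x)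
               \<le> 3 ^ n * exp (\<eta> / 6 * L x) * exp (- z * L x)"
        by (intro mult_right_mono mult_left_mono) auto
      also have "3 ^ n * ((\<eta> / 6 * L x) ^ n / fact n) * exp (- z * L x) = f n x"
        unfolding f_def by (simp flip: power_mult_distrib)
      also have "3 ^ n * exp (\<eta> / 6 * L x) * exp (- z * L x) = 3 ^ n * exp (- (p + \<eta> / 6) * L x)"
        by (simp add: z_def exp_add [symmetric] field_simps)
      finally show ?case using elim \<eta>(1) by (simp add: f_def)
    qed
  qed simp
  have "(\<integral>\<^sup>+x. exp (- (z - \<eta> / 2) * L x) \<partial>N) = (\<integral>\<^sup>+x. (\<Sum>n. ennreal (f n x)) \<partial>N)"
  proof (rule nn_integral_cong_AE, use L_nonneg in eventually_elim)
    case (elim x)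
    have "f n x = (\<eta> / 2 * L x) ^ n /\<^sub>R fact n * exp (- z * L x)" for n
      unfolding f_def by (simp only: real_scaleR_def divide_inverse mult_ac)
    hence f_eq: "(\<lambda>n. f n x) = (\<lambda>n. (\<eta> / 2 * L x) ^ n /\<^sub>R fact n * exp (- z * L x))"
      by (rule ext)
    have "exp (\<eta> / 2 * L x) * exp (- z * L x) = exp (- (z - \<eta> / 2) * L x)"
      by (simp add: exp_add [symmetric] algebra_simps)
    hence "(\<lambda>n. f n x) sums exp (- (z - \<eta> / 2) * L x)"
      unfolding f_eq using sums_mult2[OF exp_converges[of "\<eta> / 2 * L x"], of "exp (- z * L x)"]
      by (simp only:)
    moreover have "0 \<le> f n x" for n using elim \<eta>(1) by (simp add: f_def)
    ultimately have "(\<lambda>n. ennreal (f n x)) sums ennreal (exp (- (z - \<eta> / 2) * L x))"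
      by (subst sums_ennreal) auto
    thus ?case by (rule sums_unique)
  qed
  also have "\<dots> = (\<Sum>n. ennreal (\<integral>x. f n x \<partial>N))"
    by (subst nn_integral_suminf) (simp_all add: nn_integral_eq_integral[OF f_int f_nonneg])
  also have "\<dots> < \<infinity>"
  proof -
    have "summable (\<lambda>n. \<integral>x. f n x \<partial>N)"
      using summ[unfolded c_eq] by (simp only: summable_complex_of_real)
    hence "(\<Sum>n. ennreal (\<integral>x. f n x \<partial>N)) \<noteq> top"
      by (rule ennreal_suminf_neq_top) (rule integral_nonneg_AE[OF f_nonneg])
    thus ?thesis by (simp add: less_top)
  qed
  finally have "z - \<eta> / 2 \<in> S"
    unfolding S_def by (intro CollectI integrableI_nonneg) simp_all
  hence "p \<le> z - \<eta> / 2" unfolding p_def using bdd by (rule cInf_lower)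
  thus False using \<eta>(1) by (simp add: z_def)
qed

end

section \<open>Growth and measurability of the error term\<close>

lemma of_real_powr_eq_exp: "of_real x powr s = exp (s * of_real (ln x))" if "0 < x" for s :: complex
  using that by (simp add: powr_def Ln_of_real)

text \<open>
  One circle serves every \<open>x\<close>: it avoids all other singularities of \<open>D\<close> and the origin, and it stays
  on or to the left of the line \<open>Re s = \<sigma>\<close>, so that \<open>x powr s\<close> is at most \<open>x powr \<sigma>\<close> on it. Growth and continuity of the
  residue in \<open>x\<close> can then be read off the contour integral.
\<close>

lemma residue_powr_circle:
  assumes iso: "isolated_singularity_at D \<rho>" and \<rho>: "0 < Re \<rho>" "Re \<rho> < \<sigma>"
  obtains r where "0 < r" "r \<le> Re \<rho> / 2" "r \<le> \<sigma> - Re \<rho>" "continuous_on (sphere \<rho> r) D"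
    "\<And>x. ((\<lambda>s. D s * of_real x powr s / s) has_contour_integral
        2 * pi * \<i> * residue (\<lambda>s. D s * of_real x powr s / s) \<rho>) (circlepath \<rho> r)"
proof -
  obtain r0 where r0: "r0 > 0" "D analytic_on ball \<rho> r0 - {\<rho>}"
    using iso unfolding isolated_singularity_at_def by blast
  define r where "r = min (r0 / 2) (min (Re \<rho> / 2) (\<sigma> - Re \<rho>))"
  have "0 < r" "r \<le> r0 / 2" "r \<le> Re \<rho> / 2" "r \<le> \<sigma> - Re \<rho>"
    using r0(1) \<rho> unfolding r_def by (auto simp: min_def)
  hence r: "0 < r" "2 * r \<le> r0" "2 * r \<le> Re \<rho>" "r \<le> \<sigma> - Re \<rho>" by simp_all
  have hol: "D holomorphic_on ball \<rho> (2 * r) - {\<rho>}"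
    using analytic_imp_holomorphic[OF r0(2)] by (rule holomorphic_on_subset) (use r(2) in auto)
  have nz: "0 \<notin> ball \<rho> (2 * r)"
    using r(3) complex_Re_le_cmod[of \<rho>] by simp
  show ?thesis
  proof (rule that[of r])
    show "continuous_on (sphere \<rho> r) D"
      using holomorphic_on_imp_continuous_on[OF hol] by (rule continuous_on_subset) (use r in auto)
    fix x :: real
    show "((\<lambda>s. D s * of_real x powr s / s) has_contour_integral
        2 * pi * \<i> * residue (\<lambda>s. D s * of_real x powr s / s) \<rho>) (circlepath \<rho> r)"
    proof (rule base_residue[of "ball \<rho> (2 * r)"])
      show "(\<lambda>s. D s * of_real x powr s / s) holomorphic_on ball \<rho> (2 * r) - {\<rho>}"
        using hol nz by (auto intro!: holomorphic_intros)
    qed (use r in auto)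
  qed (use r in auto)
qed

lemma residue_powr_bound:
  assumes iso: "isolated_singularity_at D \<rho>" and \<rho>: "0 < Re \<rho>" "Re \<rho> < \<sigma>"
  shows "\<exists>C. \<forall>x\<ge>1. norm (residue (\<lambda>s. D s * of_real x powr s / s) \<rho>) \<le> C * x powr \<sigma>"
proof -
  obtain r where r: "0 < r" "r \<le> Re \<rho> / 2" "r \<le> \<sigma> - Re \<rho>" "continuous_on (sphere \<rho> r) D"
    and hci: "\<And>x. ((\<lambda>s. D s * of_real x powr s / s) has_contour_integral
        2 * pi * \<i> * residue (\<lambda>s. D s * of_real x powr s / s) \<rho>) (circlepath \<rho> r)"
    by (rule residue_powr_circle[OF assms]) blast
  have "bounded (D ` sphere \<rho> r)"
    using r(4) by (intro compact_imp_bounded compact_continuous_image) auto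
  then obtain B where B: "0 < B" "\<And>s. s \<in> sphere \<rho> r \<Longrightarrow> norm (D s) \<le> B"
    by (auto simp: bounded_pos)
  have "norm (residue (\<lambda>s. D s * of_real x powr s / s) \<rho>) \<le> (B / (Re \<rho> / 2) * r) * x powr \<sigma>"
    if x: "1 \<le> x" for x
  proof -
    have "norm (2 * pi * \<i> * residue (\<lambda>s. D s * of_real x powr s / s) \<rho>)
        \<le> B * x powr \<sigma> / (Re \<rho> / 2) * (2 * pi * r)"
    proof (rule has_contour_integral_bound_circlepath[OF hci _ r(1)])
      fix s assume s: "norm (s - \<rho>) = r"
      have "Re s \<le> \<sigma>" "Re \<rho> / 2 \<le> Re s"
        using s r abs_Re_le_cmod[of "s - \<rho>"] by auto
      hence "norm (of_real x powr s) \<le> x powr \<sigma>" "Re \<rho> / 2 \<le> norm s"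
        using x complex_Re_le_cmod[of s]
        by (auto simp: norm_powr_real_powr intro: powr_mono)
      thus "norm (D s * of_real x powr s / s) \<le> B * x powr \<sigma> / (Re \<rho> / 2)"
        using B s \<rho> unfolding norm_mult norm_divide
        by (intro frac_le mult_mono) (auto simp: dist_norm norm_minus_commute)
    qed (use B \<rho> in auto)
    hence "(2 * pi) * norm (residue (\<lambda>s. D s * of_real x powr s / s) \<rho>)
        \<le> (2 * pi) * ((B / (Re \<rho> / 2) * r) * x powr \<sigma>)"
      by (simp add: norm_mult algebra_simps)
    thus ?thesis by (subst (asm) mult_le_cancel_left_pos) auto
  qed
  thus ?thesis by blast
qed

lemma residue_powr_continuous:
  assumes iso: "isolated_singularity_at D \<rho>" and \<rho>: "0 < Re \<rho>"
  shows "continuous_on {0<..} (\<lambda>x. residue (\<lambda>s. D s * of_real x powr s / s) \<rho>)"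
proof -
  obtain r where r: "0 < r" "r \<le> Re \<rho> / 2" "continuous_on (sphere \<rho> r) D"
    and hci: "\<And>x. ((\<lambda>s. D s * of_real x powr s / s) has_contour_integral
        2 * pi * \<i> * residue (\<lambda>s. D s * of_real x powr s / s) \<rho>) (circlepath \<rho> r)"
    by (rule residue_powr_circle[OF assms, of "Re \<rho> + 1"]) auto
  define c where "c t = circlepath \<rho> r t" for t
  have c_cont: "continuous_on A c" for A unfolding c_def circlepath_def part_circlepath_def
    by (intro continuous_intros)
  have c_sphere: "c t \<in> sphere \<rho> r" if "t \<in> {0..1}" for t
    using that r(1) path_image_circlepath[of \<rho> r] unfolding c_def path_image_def by auto
  have c_nz: "c t \<noteq> 0" if "t \<in> {0..1}" for t
  proof -
    have "norm (\<rho> - c t) = r" using c_sphere[OF that] by (simp add: dist_norm)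
    hence "Re \<rho> - Re (c t) \<le> r" using complex_Re_le_cmod[of "\<rho> - c t"] by simp
    thus ?thesis using r(2) \<rho> by auto
  qed
  have Dc: "continuous_on {0..1} (\<lambda>t. D (c t))"
    using continuous_on_compose2[OF r(3) c_cont] c_sphere by blast
  define f where "f x t = D (c t) * exp (c t * of_real (ln x)) / c t * (2 * pi * \<i> * r * exp (2 * of_real pi * \<i> * t))"
    for x t :: real
  have "continuous_on ({0<..} \<times> cbox 0 1) (\<lambda>(x, t). f x t)"
    unfolding f_def case_prod_beta
    by (intro continuous_intros continuous_on_compose2[OF Dc continuous_on_snd]
              continuous_on_compose2[OF c_cont continuous_on_snd]) (auto dest: c_nz)
  hence "continuous_on {0<..} (\<lambda>x. integral (cbox 0 1) (f x) / (2 * pi * \<i>))"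
    by (intro continuous_intros integral_continuous_on_param) auto
  moreover have "integral (cbox 0 1) (f x) / (2 * pi * \<i>) = residue (\<lambda>s. D s * of_real x powr s / s) \<rho>"
    if "x > 0" for x
  proof -
    have "integral (cbox 0 1) (f x) = contour_integral (circlepath \<rho> r) (\<lambda>s. D s * of_real x powr s / s)"
      unfolding contour_integral_integral f_def c_def of_real_powr_eq_exp[OF that]
      by (simp add: vector_derivative_circlepath)
    thus ?thesis using contour_integral_unique[OF hci[of x]] by simp
  qed
  ultimately show ?thesis by (rule continuous_on_eq) auto
qed

text \<open>
  For \<open>n \<le> x\<close> the weight \<open>(x / n) powr \<sigma>\<close> is at least 1, so the partial sum of \<open>\<bar>a n\<bar>\<close> is at most
  \<open>x powr \<sigma>\<close> times the sum of the Dirichlet series of absolute values at \<open>\<sigma>\<close>. A factor 2 covers the halved last term.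
\<close>

lemma starred_sum_bound:
  assumes "(\<lambda>n. norm (dirichlet_term a (of_real \<sigma>) n)) summable_on {1..}" and "0 \<le> \<sigma>"
  shows "\<exists>C. \<forall>x\<ge>1. \<bar>starred_sum a x\<bar> \<le> C * x powr \<sigma>"
proof -
  define B where "B = (\<Sum>\<^sub>\<infinity>n\<in>{1..}. norm (dirichlet_term a (of_real \<sigma>) n))"
  have nt: "norm (dirichlet_term a (of_real \<sigma>) n) = \<bar>a n\<bar> * real n powr (- \<sigma>)" for n
    unfolding dirichlet_term_def norm_mult by (subst norm_powr_real_powr) auto
  have sub: "(\<Sum>n\<in>I. \<bar>a n\<bar>) \<le> B * x powr \<sigma>" if I: "finite I" "I \<subseteq> {1..}" "\<And>n. n \<in> I \<Longrightarrow> real n \<le> x" for I x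
  proof -
    have "(\<Sum>n\<in>I. \<bar>a n\<bar>) \<le> (\<Sum>n\<in>I. norm (dirichlet_term a (of_real \<sigma>) n) * x powr \<sigma>)"
    proof (rule sum_mono)
      fix n assume n: "n \<in> I"
      hence "1 \<le> n" using I by auto
      hence "\<bar>a n\<bar> = \<bar>a n\<bar> * real n powr (- \<sigma>) * real n powr \<sigma>"
        by (simp add: powr_minus)
      also have "\<dots> \<le> \<bar>a n\<bar> * real n powr (- \<sigma>) * x powr \<sigma>"
        using I(3)[OF n] assms(2) by (intro mult_left_mono powr_mono2) auto
      finally show "\<bar>a n\<bar> \<le> norm (dirichlet_term a (of_real \<sigma>) n) * x powr \<sigma>"
        unfolding nt .
    qed
    also have "\<dots> \<le> B * x powr \<sigma>"
      unfolding sum_distrib_right[symmetric] B_def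
      by (rule mult_right_mono[OF finite_sum_le_infsum[OF assms(1) I(1,2)]]) simp_all
    finally show ?thesis .
  qed
  have "\<bar>starred_sum a x\<bar> \<le> 2 * B * x powr \<sigma>" if x: "1 \<le> x" for x
  proof -
    define I where "I = {n. 1 \<le> n \<and> real n \<le> x}"
    have "finite I" unfolding I_def
      by (rule finite_subset[of _ "{..nat \<lfloor>x\<rfloor>}"]) (auto simp: le_nat_floor)
    hence "(\<Sum>n\<in>I. \<bar>a n\<bar>) \<le> B * x powr \<sigma>"
      by (rule sub) (auto simp: I_def)
    hence "\<bar>\<Sum>n\<in>I. a n\<bar> \<le> B * x powr \<sigma>"
      by (rule order_trans[OF sum_abs])
    moreover have "\<bar>a (nat \<lfloor>x\<rfloor>)\<bar> \<le> B * x powr \<sigma>"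
      using sub[of "{nat \<lfloor>x\<rfloor>}" x] x by (simp add: le_nat_floor)
    ultimately show ?thesis unfolding starred_sum_def I_def[symmetric] by auto
  qed
  thus ?thesis by blast
qed

lemma starred_sum_measurable [measurable]: "starred_sum a \<in> borel_measurable borel"
proof -
  have eq: "starred_sum a = (\<lambda>x. (\<Sum>n\<in>{1..nat \<lfloor>x\<rfloor>}. a n) - (if x \<in> \<nat> then a (nat \<lfloor>x\<rfloor>) / 2 else 0))"
  proof
    fix x
    have "{n. 1 \<le> n \<and> real n \<le> x} = {1..nat \<lfloor>x\<rfloor>}"
      by (auto simp: le_nat_floor) linarith
    thus "starred_sum a x = (\<Sum>n\<in>{1..nat \<lfloor>x\<rfloor>}. a n) - (if x \<in> \<nat> then a (nat \<lfloor>x\<rfloor>) / 2 else 0)"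
      by (simp add: starred_sum_def)
  qed
  have [measurable]: "(\<nat> :: real set) \<in> sets borel"
    by (intro borel_closed closed_Nats)
  have nf: "(\<lambda>x::real. nat \<lfloor>x\<rfloor>) \<in> borel \<rightarrow>\<^sub>M count_space UNIV" by measurable
  have [measurable]: "(\<lambda>x::real. (\<Sum>n\<in>{1..nat \<lfloor>x\<rfloor>}. a n)) \<in> borel_measurable borel"
    by (rule measurable_compose[OF nf, of "\<lambda>k. \<Sum>n\<in>{1..k}. a n" borel]) simp
  have [measurable]: "(\<lambda>x::real. a (nat \<lfloor>x\<rfloor>)) \<in> borel_measurable borel"
    by (rule measurable_compose[OF nf, of a borel]) simp
  show ?thesis unfolding eq
    by (intro borel_measurable_diff measurable_If borel_measurable_divide) measurable
qed

lemma
  assumes mero: "D meromorphic_on {s. \<sigma>\<^sub>1 < Re s}" and "0 < \<sigma>\<^sub>1"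
    and poles: "\<And>\<rho>. \<rho> \<in> poles_right_of D \<sigma>\<^sub>1 \<Longrightarrow> Re \<rho> \<le> \<sigma>\<^sub>2"
  shows main_term_bound: "\<sigma>\<^sub>2 < \<sigma> \<Longrightarrow> \<exists>C. \<forall>x\<ge>1. norm (main_term D \<sigma>\<^sub>1 x) \<le> C * x powr \<sigma>"
    and main_term_continuous: "continuous_on {1..} (main_term D \<sigma>\<^sub>1)"
proof -
  have iso: "isolated_singularity_at D \<rho>" "0 < Re \<rho>" "\<sigma>\<^sub>2 < \<sigma> \<Longrightarrow> Re \<rho> < \<sigma>" if "\<rho> \<in> poles_right_of D \<sigma>\<^sub>1" for \<rho> \<sigma>
    using that mero poles[OF that] \<open>0 < \<sigma>\<^sub>1\<close>
    by (auto simp: poles_right_of_def meromorphic_on_altdef)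
  show "\<exists>C. \<forall>x\<ge>1. norm (main_term D \<sigma>\<^sub>1 x) \<le> C * x powr \<sigma>" if \<sigma>: "\<sigma>\<^sub>2 < \<sigma>"
  proof -
    have "\<forall>\<rho>\<in>poles_right_of D \<sigma>\<^sub>1. \<exists>C. \<forall>x\<ge>1. norm (residue (\<lambda>s. D s * of_real x powr s / s) \<rho>) \<le> C * x powr \<sigma>"
      by (intro ballI residue_powr_bound iso \<sigma>)
    from bchoice[OF this] obtain C where C: "\<forall>\<rho>\<in>poles_right_of D \<sigma>\<^sub>1. \<forall>x\<ge>1.
        norm (residue (\<lambda>s. D s * of_real x powr s / s) \<rho>) \<le> C \<rho> * x powr \<sigma>" by blast
    show ?thesis
    proof (intro exI allI impI)
      fix x :: real assume "1 \<le> x"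
      hence "norm (main_term D \<sigma>\<^sub>1 x) \<le> (\<Sum>\<rho>\<in>poles_right_of D \<sigma>\<^sub>1. C \<rho> * x powr \<sigma>)"
        unfolding main_term_def using C by (intro sum_norm_le) auto
      thus "norm (main_term D \<sigma>\<^sub>1 x) \<le> (\<Sum>\<rho>\<in>poles_right_of D \<sigma>\<^sub>1. C \<rho>) * x powr \<sigma>"
        by (simp only: sum_distrib_right)
    qed
  qed
  show "continuous_on {1..} (main_term D \<sigma>\<^sub>1)" unfolding main_term_def
    by (rule continuous_on_sum, rule continuous_on_subset[OF residue_powr_continuous[OF iso(1,2)]]) auto
qed


lemma
  assumes mero: "D meromorphic_on {s. \<sigma>\<^sub>1 < Re s}" and "0 < \<sigma>\<^sub>1"
    and poles: "\<And>\<rho>. \<rho> \<in> poles_right_of D \<sigma>\<^sub>1 \<Longrightarrow> Re \<rho> \<le> \<sigma>\<^sub>2"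
  shows error_term_bound: "\<sigma>\<^sub>2 < \<sigma> \<Longrightarrow> 0 \<le> \<sigma> \<Longrightarrow> (\<lambda>n. norm (dirichlet_term a (of_real \<sigma>) n)) summable_on {1..}
      \<Longrightarrow> \<exists>C. \<forall>x\<ge>1. \<bar>error_term a D \<sigma>\<^sub>1 x\<bar> \<le> C * x powr \<sigma>"
    and error_term_measurable: "(\<lambda>x. indicator {1..} x * error_term a D \<sigma>\<^sub>1 x) \<in> borel_measurable borel"
proof -
  show "\<exists>C. \<forall>x\<ge>1. \<bar>error_term a D \<sigma>\<^sub>1 x\<bar> \<le> C * x powr \<sigma>"
    if \<sigma>: "\<sigma>\<^sub>2 < \<sigma>" "0 \<le> \<sigma>" "(\<lambda>n. norm (dirichlet_term a (of_real \<sigma>) n)) summable_on {1..}"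
  proof -
    obtain C1 where C1: "\<forall>x\<ge>1. norm (main_term D \<sigma>\<^sub>1 x) \<le> C1 * x powr \<sigma>"
      using main_term_bound[OF assms \<sigma>(1)] by blast
    obtain C2 where C2: "\<forall>x\<ge>1. \<bar>starred_sum a x\<bar> \<le> C2 * x powr \<sigma>"
      using starred_sum_bound[OF \<sigma>(3,2)] by blast
    have "\<bar>error_term a D \<sigma>\<^sub>1 x\<bar> \<le> (C1 + C2) * x powr \<sigma>" if "1 \<le> x" for x
    proof -
      have "\<bar>Re (main_term D \<sigma>\<^sub>1 x)\<bar> \<le> C1 * x powr \<sigma>"
        using C1 that abs_Re_le_cmod order_trans by blast
      moreover have "\<bar>starred_sum a x\<bar> \<le> C2 * x powr \<sigma>" using C2 that by blast
      ultimately show ?thesis unfolding error_term_def distrib_right by linarith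
    qed
    thus ?thesis by blast
  qed
  have [measurable]: "(\<lambda>x. indicator {1..} x *\<^sub>R Re (main_term D \<sigma>\<^sub>1 x)) \<in> borel_measurable borel"
    by (intro borel_measurable_continuous_on_indicator continuous_intros main_term_continuous[OF assms]) auto
  have "(\<lambda>x. indicator {1..} x * starred_sum a x - indicator {1..} x *\<^sub>R Re (main_term D \<sigma>\<^sub>1 x))
      \<in> borel_measurable borel" by measurable
  thus "(\<lambda>x. indicator {1..} x * error_term a D \<sigma>\<^sub>1 x) \<in> borel_measurable borel"
    by (simp add: error_term_def algebra_simps)
qed

section \<open>Mellin transforms\<close>

text \<open>
  The transform of the comparison function \<open>c x powr \<sigma>\<^sub>0\<close> comes from this integral
  with \<open>z = s - \<sigma>\<^sub>0\<close>.
\<close>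

lemma
  fixes z :: complex
  assumes z: "0 < Re z"
  shows set_integrable_powr_atLeast_1: "set_integrable lborel {1..} (\<lambda>x. of_real x powr (- z - 1))"
    and set_integral_powr_atLeast_1: "(CLINT x:{1..}|lborel. of_real x powr (- z - 1)) = 1 / z"
proof -
  define f where "f x = (of_real x powr (- z - 1) :: complex)" for x :: real
  have f_eq: "f x = exp ((- z - 1) * of_real (ln x))" if "0 < x" for x
    using that by (simp add: f_def of_real_powr_eq_exp)
  have [measurable]: "f \<in> borel_measurable borel" unfolding f_def by measurable
  have "((\<lambda>x. x powr (- Re z - 1)) has_integral - (1 powr (- Re z - 1 + 1)) / (- Re z - 1 + 1)) {1..}"
    using z by (intro has_integral_powr_to_inf) auto
  hence "set_integrable lebesgue {1..} (\<lambda>x. x powr (- Re z - 1))"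
    by (intro nonnegative_absolutely_integrable_1) (auto simp: integrable_on_def)
  hence r: "integrable lborel (\<lambda>x. indicator {1..} x *\<^sub>R (x powr (- Re z - 1)))"
    unfolding set_integrable_def by (subst (asm) integrable_completion) measurable
  have "integrable lborel (\<lambda>x. indicator {1..} x *\<^sub>R f x)"
    by (rule Bochner_Integration.integrable_bound[OF r])
       (auto simp: indicator_def f_def norm_powr_real_powr)
  thus int: "set_integrable lborel {1..} (\<lambda>x. of_real x powr (- z - 1))"
    by (simp add: set_integrable_def f_def)
  have "(LBINT x=ereal 1..\<infinity>. f x) = 0 - (- 1 / z)"
  proof (rule interval_integral_FTC_integrable[where F = "\<lambda>x. - exp (- z * of_real (ln x)) / z"])
    fix x :: real assume "ereal 1 < ereal x" "ereal x < \<infinity>"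
    hence x: "1 < x" by simp
    have ln: "((\<lambda>y. of_real (ln y) :: complex) has_vector_derivative of_real (1 / x)) (at x)"
      using x by (intro has_vector_derivative_of_real) (auto intro!: derivative_eq_intros)
    have "((\<lambda>w. - exp (- z * w) / z) has_field_derivative exp (- z * of_real (ln x))) (at (of_real (ln x)))"
      using z by (auto intro!: derivative_eq_intros)
    from field_vector_diff_chain_at[OF ln this]
    have "((\<lambda>y. - exp (- z * of_real (ln y)) / z) has_vector_derivative
        of_real (1 / x) * exp (- z * of_real (ln x))) (at x)"
      by (simp add: o_def)
    also have "of_real (1 / x) * exp (- z * of_real (ln x)) = f x"
    proof -
      have "exp (of_real (ln x) :: complex) = of_real x" using x by (simp add: exp_of_real)
      moreover have "f x = exp (- z * of_real (ln x) - of_real (ln x))"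
        using x by (simp add: f_eq algebra_simps)
      ultimately show ?thesis by (simp add: exp_diff)
    qed
    finally show "((\<lambda>y. - exp (- z * of_real (ln y)) / z) has_vector_derivative f x) (at x)" .
    show "isCont f x"
    proof -
      have "isCont (\<lambda>x. exp ((- z - 1) * of_real (ln x))) x" using x by (intro continuous_intros) auto
      moreover have "eventually (\<lambda>y. exp ((- z - 1) * of_real (ln y)) = f y) (nhds x)"
        using x eventually_nhds_in_open[of "{0<..}" x]
        by (auto elim!: eventually_mono simp: f_eq)
      ultimately show ?thesis using isCont_cong by fast
    qed
  next
    show "set_integrable lborel (einterval (ereal 1) \<infinity>) f"
      using int unfolding f_def[symmetric]
      by (rule set_integrable_subset) (auto simp: einterval_def)
    show "(((\<lambda>x. - exp (- z * of_real (ln x)) / z) \<circ> real_of_ereal) \<longlongrightarrow> - 1 / z) (at_right (ereal 1))"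
      unfolding ereal_tendsto_simps
      by (rule tendsto_eq_intros refl | use z in force)+
    show "(((\<lambda>x. - exp (- z * of_real (ln x)) / z) \<circ> real_of_ereal) \<longlongrightarrow> 0) (at_left \<infinity>)"
      unfolding ereal_tendsto_simps
    proof (rule tendsto_norm_zero_cancel)
      have "((\<lambda>x. x powr (- Re z) / norm z) \<longlongrightarrow> 0) at_top"
        using z by (intro tendsto_divide_zero tendsto_neg_powr filterlim_ident) auto
      moreover have "eventually (\<lambda>x. x powr (- Re z) / norm z = norm (- exp (- z * of_real (ln x)) / z)) at_top"
        using eventually_gt_at_top[of 0]
        by eventually_elim (simp add: norm_divide powr_def)
      ultimately show "((\<lambda>x. norm (- exp (- z * of_real (ln x)) / z)) \<longlongrightarrow> 0) at_top"
        by (rule Lim_transform_eventually)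
    qed
  qed auto
  also have "(LBINT x=ereal 1..\<infinity>. f x) = (CLINT x:{1<..}|lborel. f x)"
    by (rule interval_integral_to_infinity_eq)
  also have "\<dots> = (CLINT x:{1..}|lborel. f x)"
    unfolding set_lebesgue_integral_def
    by (intro integral_cong_AE) (use AE_lborel_singleton[of 1] in \<open>auto simp: indicator_def elim!: eventually_mono\<close>)
  finally show "(CLINT x:{1..}|lborel. of_real x powr (- z - 1)) = 1 / z"
    by (simp add: f_def)
qed

text \<open>
  The factor \<open>1 / x\<close> makes the Laplace transform of this measure with exponent \<open>ln\<close> equal to the integral of
  \<open>w x * x powr (- s - 1)\<close> over \<open>x \<ge> 1\<close>.
\<close>

definition mellin_measure :: "(real \<Rightarrow> real) \<Rightarrow> real measure" where
  "mellin_measure w = density lborel (\<lambda>x. ennreal (indicator {1..} x * w x / x))"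

context
  fixes w :: "real \<Rightarrow> real"
  assumes w_meas [measurable]: "w \<in> borel_measurable borel" and w_nonneg: "\<And>x. 0 \<le> w x"
begin

lemma AE_mellin_measure_ln: "AE x in mellin_measure w. 0 \<le> ln x"
  unfolding mellin_measure_def by (subst AE_density) (auto simp: indicator_def)

lemma mellin_density_nonneg: "0 \<le> indicator {1..} x * w x / x"
  using w_nonneg by (auto simp: indicator_def)

lemma mellin_measure_integrable_iff:
  "integrable (mellin_measure w) (\<lambda>x. exp (- \<sigma> * ln x)) \<longleftrightarrow>
   set_integrable lborel {1..} (\<lambda>x. w x * x powr (- \<sigma> - 1))"
proof -
  have "(indicator {1..} x * w x / x) *\<^sub>R exp (- \<sigma> * ln x) = indicator {1..} x *\<^sub>R (w x * x powr (- \<sigma> - 1))" for x :: real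
    by (auto simp: indicator_def powr_def left_diff_distrib exp_diff)
  thus ?thesis
    unfolding mellin_measure_def set_integrable_def
    by (subst integrable_density) (use mellin_density_nonneg in simp_all)
qed

lemma laplace_mellin_measure:
  "laplace (mellin_measure w) ln s = (CLINT x:{1..}|lborel. of_real (w x) * of_real x powr (- s - 1))"
proof -
  have "(indicator {1..} x * w x / x) *\<^sub>R exp (- s * of_real (ln x))
      = indicator {1..} x *\<^sub>R (of_real (w x) * of_real x powr (- s - 1))" for x :: real
  proof (cases "1 \<le> x")
    case True
    hence "exp (of_real (ln x) :: complex) = of_real x" by (simp add: exp_of_real)
    with True show ?thesis
      by (simp add: of_real_powr_eq_exp left_diff_distrib exp_diff scaleR_conv_of_real)
  qed simp
  thus ?thesis
    unfolding mellin_measure_def laplace_def set_lebesgue_integral_def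
    by (subst integral_density) (use mellin_density_nonneg in simp_all)
qed

end

lemma norm_of_real_mult_powr:
  "1 \<le> x \<Longrightarrow> norm (of_real v * of_real x powr (- s - 1)) = \<bar>v\<bar> * x powr (- Re s - 1)"
  by (simp add: norm_mult norm_powr_real_powr)

lemma of_real_powr_kernel:
  "0 \<le> x \<Longrightarrow> of_real x powr (- of_real \<sigma> - 1) = (of_real (x powr (- \<sigma> - 1)) :: complex)"
  using powr_of_real[of x "- \<sigma> - 1"] by simp

lemma set_integrable_complex_powr:
  assumes [measurable]: "v \<in> borel_measurable borel"
    and "set_integrable lborel {1..} (\<lambda>x. v x * x powr (- Re s - 1))"
  shows "set_integrable lborel {1..} (\<lambda>x. of_real (v x) * of_real x powr (- s - 1) :: complex)"
  using assms(2) unfolding set_integrable_def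
  by (rule Bochner_Integration.integrable_bound)
     (auto simp: indicator_def norm_of_real_mult_powr abs_mult)

lemma error_mellin_eq_lborel:
  assumes [measurable]: "\<Delta> \<in> borel_measurable borel"
  shows "error_mellin \<Delta> s = (CLINT x:{1..}|lborel. of_real (\<Delta> x) * of_real x powr (- s - 1))"
  unfolding error_mellin_def set_lebesgue_integral_def by (subst integral_completion) measurable

text \<open>
  The analytic heart. Let \<open>u\<close> and \<open>v\<close> be the positive and the negative part of \<open>c x powr \<sigma>\<^sub>0 - \<Delta> x\<close>, with
  transforms \<open>U\<close> and \<open>V\<close>. The integral in the statement is \<open>V (\<sigma>\<^sub>0 + \<delta>)\<close>; suppose it were \<open>o (1 / \<delta>)\<close>. Then \<open>V\<close>
  converges to the right of \<open>\<sigma>\<^sub>0\<close>, and \<open>U s = c / (s - \<sigma>\<^sub>0) - A s + V s\<close> continues analytically to \<open>R\<close>, which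
  contains the half-line. By Landau's theorem \<open>U\<close> converges to the right of \<open>\<sigma>\<^sub>0\<close> as well. Now compare
  \<open>\<sigma> + i t\<^sub>0\<close> with \<open>\<sigma>\<close>: up to \<open>O (1)\<close>, which absorbs \<open>c / (s - \<sigma>\<^sub>0)\<close> since \<open>t\<^sub>0 \<noteq> 0\<close>, the modulus of
  \<open>A (\<sigma> + i t\<^sub>0)\<close> is at most \<open>U \<sigma> + V \<sigma> = c / (\<sigma> - \<sigma>\<^sub>0) - A \<sigma> + 2 V \<sigma>\<close>. Multiplication by \<open>\<sigma> - \<sigma>\<^sub>0\<close> and passage to
  the limit give \<open>lam \<le> c - l\<close>, a contradiction.

  The extended nonnegative real \<open>ennreal\<close> sends negative numbers to 0, so the integral is over the set where
  \<open>\<Delta> x > c x powr \<sigma>\<^sub>0\<close>.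
\<close>

theorem mellin_excess_not_negligible:
  fixes \<Delta> :: "real \<Rightarrow> real" and A :: "complex \<Rightarrow> complex" and c lam l :: real
  assumes \<Delta>_meas [measurable]: "\<Delta> \<in> borel_measurable borel"
    and int: "\<And>\<sigma>. \<sigma>\<^sub>2 < \<sigma> \<Longrightarrow> set_integrable lborel {1..} (\<lambda>x. \<Delta> x * x powr (- \<sigma> - 1))"
    and A: "continues_in_half_plane \<sigma>\<^sub>0 \<sigma>\<^sub>2 (error_mellin \<Delta>) A R"
    and \<sigma>\<^sub>0: "\<sigma>\<^sub>0 < \<sigma>\<^sub>2"
    and half_line: "\<And>\<sigma>. \<sigma>\<^sub>0 < \<sigma> \<Longrightarrow> of_real \<sigma> \<in> R"
    and t\<^sub>0: "t\<^sub>0 \<noteq> 0" "\<forall>\<^sub>F \<sigma> in at_right \<sigma>\<^sub>0. Complex \<sigma> t\<^sub>0 \<in> R"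
    and lam: "Limsup (at_right \<sigma>\<^sub>0) (\<lambda>\<sigma>. ereal ((\<sigma> - \<sigma>\<^sub>0) * norm (A (Complex \<sigma> t\<^sub>0)))) = ereal lam"
    and l: "Liminf (at_right \<sigma>\<^sub>0) (\<lambda>\<sigma>. ereal ((\<sigma> - \<sigma>\<^sub>0) * Re (A (of_real \<sigma>)))) = ereal l"
    and c: "c < l + lam"
  shows "\<not> ((\<lambda>\<delta>. ennreal \<delta> * (\<integral>\<^sup>+x\<in>{1..}. ennreal ((\<Delta> x - c * x powr \<sigma>\<^sub>0) * x powr (- (\<sigma>\<^sub>0 + \<delta>) - 1)) \<partial>lborel))
           \<longlongrightarrow> 0) (at_right 0)"
proof
  define P where "P \<delta> = (\<integral>\<^sup>+x\<in>{1..}. ennreal ((\<Delta> x - c * x powr \<sigma>\<^sub>0) * x powr (- (\<sigma>\<^sub>0 + \<delta>) - 1)) \<partial>lborel)" for \<delta>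
  assume "((\<lambda>\<delta>. ennreal \<delta> * (\<integral>\<^sup>+x\<in>{1..}. ennreal ((\<Delta> x - c * x powr \<sigma>\<^sub>0) * x powr (- (\<sigma>\<^sub>0 + \<delta>) - 1)) \<partial>lborel))
           \<longlongrightarrow> 0) (at_right 0)"
  hence P_lim: "((\<lambda>\<delta>. ennreal \<delta> * P \<delta>) \<longlongrightarrow> 0) (at_right 0)" by (simp only: P_def)
  have R: "open R" "connected R" "{s. \<sigma>\<^sub>2 < Re s} \<subseteq> R" "R \<subseteq> {s. \<sigma>\<^sub>0 < Re s}" "A holomorphic_on R"
    and A_eq: "\<And>s. \<sigma>\<^sub>2 < Re s \<Longrightarrow> A s = (CLINT x:{1..}|lborel. of_real (\<Delta> x) * of_real x powr (- s - 1))"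
    using A by (auto simp: continues_in_half_plane_def error_mellin_eq_lborel[OF \<Delta>_meas])
  \<comment> \<open>The integral decreases in \<open>\<delta>\<close> because \<open>x \<ge> 1\<close>, so finiteness near 0 gives finiteness everywhere.\<close>
  have P_fin: "P \<delta> < \<infinity>" if "0 < \<delta>" for \<delta>
  proof -
    have "\<forall>\<^sub>F y in at_right 0. ennreal y * P y < 1 \<and> y < \<delta> \<and> 0 < y"
      using order_tendstoD(2)[OF P_lim, of 1] eventually_at_right_real[OF that]
      by (auto elim: eventually_elim2)
    then obtain y where y: "ennreal y * P y < 1" "y < \<delta>" "0 < y"
      using eventually_happens'[OF trivial_limit_at_right_real] by blast
    have "P \<delta> \<le> P y" unfolding P_def
    proof (intro nn_integral_mono)
      fix x :: real
      show "ennreal ((\<Delta> x - c * x powr \<sigma>\<^sub>0) * x powr (- (\<sigma>\<^sub>0 + \<delta>) - 1)) * indicator {1..} x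
          \<le> ennreal ((\<Delta> x - c * x powr \<sigma>\<^sub>0) * x powr (- (\<sigma>\<^sub>0 + y) - 1)) * indicator {1..} x"
      proof (cases "1 \<le> x \<and> 0 \<le> \<Delta> x - c * x powr \<sigma>\<^sub>0")
        case True
        thus ?thesis using y by (intro mult_right_mono ennreal_leI mult_left_mono powr_mono) auto
      next
        case False
        thus ?thesis by (auto simp: indicator_def ennreal_neg mult_nonpos_nonneg)
      qed
    qed
    also have "P y < \<infinity>" using y by (auto simp: less_top[symmetric] ennreal_mult_top)
    finally show ?thesis .
  qed
  define u v where "u x = max 0 (c * x powr \<sigma>\<^sub>0 - \<Delta> x)" and "v x = max 0 (\<Delta> x - c * x powr \<sigma>\<^sub>0)" for x
  have [measurable]: "u \<in> borel_measurable borel" "v \<in> borel_measurable borel"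
    unfolding u_def v_def by measurable
  have nonneg: "0 \<le> u x" "0 \<le> v x" for x by (auto simp: u_def v_def)
  define U V where "U = laplace (mellin_measure u) ln" and "V = laplace (mellin_measure v) ln"
  have ln_meas: "ln \<in> borel_measurable (mellin_measure u)" "ln \<in> borel_measurable (mellin_measure v)"
    by (simp_all add: mellin_measure_def)
  have u_meas: "u \<in> borel_measurable borel" and v_meas: "v \<in> borel_measurable borel" by measurable
  note AE_u = AE_mellin_measure_ln[OF u_meas nonneg(1)] and AE_v = AE_mellin_measure_ln[OF v_meas nonneg(2)]
  note iff_u = mellin_measure_integrable_iff[OF u_meas nonneg(1)]
    and iff_v = mellin_measure_integrable_iff[OF v_meas nonneg(2)]
  have P_eq: "P \<delta> = (\<integral>\<^sup>+x. ennreal (indicator {1..} x *\<^sub>R (v x * x powr (- (\<sigma>\<^sub>0 + \<delta>) - 1))) \<partial>lborel)" for \<delta>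
    unfolding P_def v_def
    by (intro nn_integral_cong) (auto simp: indicator_def max_def ennreal_neg mult_nonpos_nonneg)
  have v_int: "set_integrable lborel {1..} (\<lambda>x. v x * x powr (- \<sigma> - 1))" if "\<sigma>\<^sub>0 < \<sigma>" for \<sigma>
    unfolding set_integrable_def
  proof (rule integrableI_nonneg)
    show "(\<integral>\<^sup>+x. ennreal (indicator {1..} x *\<^sub>R (v x * x powr (- \<sigma> - 1))) \<partial>lborel) < \<infinity>"
      using P_fin[of "\<sigma> - \<sigma>\<^sub>0"] that unfolding P_eq by simp
  qed (use nonneg in \<open>auto intro!: AE_I2 mult_nonneg_nonneg\<close>)
  have V_nn: "ennreal (Re (V (of_real \<sigma>))) = P (\<sigma> - \<sigma>\<^sub>0)" if "\<sigma>\<^sub>0 < \<sigma>" for \<sigma>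
  proof -
    have "V (of_real \<sigma>) = (\<integral>x. of_real (indicator {1..} x *\<^sub>R (v x * x powr (- \<sigma> - 1))) \<partial>lborel)"
      unfolding V_def laplace_mellin_measure[OF v_meas nonneg(2)] set_lebesgue_integral_def
      by (intro Bochner_Integration.integral_cong refl) (auto simp: indicator_def of_real_powr_kernel)
    hence "Re (V (of_real \<sigma>)) = (\<integral>x. indicator {1..} x *\<^sub>R (v x * x powr (- \<sigma> - 1)) \<partial>lborel)"
      by (simp only: integral_complex_of_real Re_complex_of_real)
    thus ?thesis
      using v_int[OF that] nonneg unfolding P_eq set_integrable_def
      by (subst nn_integral_eq_integral) auto
  qed
  have V_hol: "V holomorphic_on {s. \<sigma>\<^sub>0 < Re s}"
    unfolding V_def by (rule laplace_holomorphic[OF ln_meas(2) AE_v]) (simp only: iff_v v_int)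
  have powr_int: "set_integrable lborel {1..} (\<lambda>x. of_real (c * x powr \<sigma>\<^sub>0) * of_real x powr (- s - 1) :: complex)"
    and powr_integral: "(CLINT x:{1..}|lborel. of_real (c * x powr \<sigma>\<^sub>0) * of_real x powr (- s - 1)) = of_real c / (s - of_real \<sigma>\<^sub>0)"
    if "\<sigma>\<^sub>0 < Re s" for s
  proof -
    have eq: "indicator {1..} x *\<^sub>R (of_real (c * x powr \<sigma>\<^sub>0) * of_real x powr (- s - 1))
        = of_real c * (indicator {1..} x *\<^sub>R (of_real x powr (- (s - of_real \<sigma>\<^sub>0) - 1)))" for x :: real
    proof (cases "1 \<le> x")
      case True
      have "of_real (x powr \<sigma>\<^sub>0) * of_real x powr (- s - 1) = (of_real x powr (- (s - of_real \<sigma>\<^sub>0) - 1) :: complex)"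
        using True by (simp add: powr_of_real [symmetric] powr_add [symmetric] algebra_simps)
      thus ?thesis by (simp add: mult.assoc)
    qed simp
    have z: "0 < Re (s - of_real \<sigma>\<^sub>0)" using that by simp
    show "set_integrable lborel {1..} (\<lambda>x. of_real (c * x powr \<sigma>\<^sub>0) * of_real x powr (- s - 1) :: complex)"
      using set_integrable_powr_atLeast_1[OF z] unfolding set_integrable_def eq
      by (rule integrable_mult_right)
    show "(CLINT x:{1..}|lborel. of_real (c * x powr \<sigma>\<^sub>0) * of_real x powr (- s - 1)) = of_real c / (s - of_real \<sigma>\<^sub>0)"
      using set_integral_powr_atLeast_1[OF z] unfolding set_lebesgue_integral_def eq
      by (simp only: integral_mult_right_zero) simp
  qed
  have u_int: "set_integrable lborel {1..} (\<lambda>x. u x * x powr (- \<sigma> - 1))" if "\<sigma>\<^sub>2 < \<sigma>" for \<sigma>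
  proof -
    have "set_integrable lborel {1..} (\<lambda>x. norm (of_real (c * x powr \<sigma>\<^sub>0) * of_real x powr (- of_real \<sigma> - 1) :: complex)
         + norm (\<Delta> x * x powr (- \<sigma> - 1)))"
      using powr_int[of "of_real \<sigma>"] int[OF that] that \<sigma>\<^sub>0 
      by (intro set_integral_add set_integrable_norm) auto
    thus ?thesis unfolding set_integrable_def
    proof (rule Bochner_Integration.integrable_bound)
      have "u x * x powr (- \<sigma> - 1) \<le> norm (of_real (c * x powr \<sigma>\<^sub>0) * of_real x powr (- of_real \<sigma> - 1) :: complex)
         + norm (\<Delta> x * x powr (- \<sigma> - 1))" if "1 \<le> x" for x
      proof -
        have "u x \<le> \<bar>c * x powr \<sigma>\<^sub>0\<bar> + \<bar>\<Delta> x\<bar>" by (auto simp: u_def)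
        hence "u x * x powr (- \<sigma> - 1) \<le> (\<bar>c * x powr \<sigma>\<^sub>0\<bar> + \<bar>\<Delta> x\<bar>) * x powr (- \<sigma> - 1)"
          by (rule mult_right_mono) simp
        thus ?thesis by (subst norm_of_real_mult_powr[OF that]) (simp add: distrib_right abs_mult)
      qed
      thus "AE x in lborel. norm (indicator {1..} x *\<^sub>R (u x * x powr (- \<sigma> - 1))) \<le>
           norm (indicator {1..} x *\<^sub>R (norm (of_real (c * x powr \<sigma>\<^sub>0) * of_real x powr (- of_real \<sigma> - 1) :: complex)
         + norm (\<Delta> x * x powr (- \<sigma> - 1))))"
        using nonneg(1) by (intro AE_I2) (auto simp: indicator_def)
    qed measurable
  qed
  define F where "F s = of_real c / (s - of_real \<sigma>\<^sub>0) - A s + V s" for s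
  have F_hol: "F holomorphic_on R"
    unfolding F_def using R V_hol
    by (intro holomorphic_intros) (auto intro: holomorphic_on_subset)
  have F_eq: "F s = U s" if s: "\<sigma>\<^sub>2 < Re s" for s
  proof -
    let ?k = "\<lambda>x::real. of_real x powr (- s - 1) :: complex"
    have ints: "set_integrable lborel {1..} (\<lambda>x. of_real (u x) * ?k x)"
        "set_integrable lborel {1..} (\<lambda>x. of_real (v x) * ?k x)"
        "set_integrable lborel {1..} (\<lambda>x. of_real (\<Delta> x) * ?k x)"
      using u_int v_int int s \<sigma>\<^sub>0 by (auto intro!: set_integrable_complex_powr)
    have "of_real c / (s - of_real \<sigma>\<^sub>0) - A s
        = (CLINT x:{1..}|lborel. of_real (c * x powr \<sigma>\<^sub>0) * ?k x - of_real (\<Delta> x) * ?k x)"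
      using powr_integral powr_int ints(3) s \<sigma>\<^sub>0 by (simp add: set_integral_diff A_eq)
    also have "\<dots> = (CLINT x:{1..}|lborel. of_real (u x) * ?k x - of_real (v x) * ?k x)"
    proof -
      have "c * x powr \<sigma>\<^sub>0 - \<Delta> x = u x - v x" for x by (auto simp: u_def v_def)
      thus ?thesis by (simp only: left_diff_distrib [symmetric] of_real_diff [symmetric])
    qed
    also have "\<dots> = U s - V s"
      using ints by (simp add: U_def V_def laplace_mellin_measure nonneg set_integral_diff)
    finally show ?thesis by (simp add: F_def)
  qed
  have u_int': "integrable (mellin_measure u) (\<lambda>x. exp (- \<sigma> * ln x))" if "\<sigma>\<^sub>0 < \<sigma>" for \<sigma>
    by (rule landau_convergence[OF ln_meas(1) AE_u R(1) F_hol half_line, where b = \<sigma>\<^sub>2])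
       (use that in \<open>simp_all only: iff_u u_int F_eq U_def\<close>)
  have U_hol: "U holomorphic_on {s. \<sigma>\<^sub>0 < Re s}"
    unfolding U_def by (rule laplace_holomorphic[OF ln_meas(1) AE_u u_int'])
  have F_eq_R: "F s = U s" if "s \<in> R" for s
  proof (rule analytic_continuation_open[of "{s. \<sigma>\<^sub>2 < Re s}" R F U])
    show "{s. \<sigma>\<^sub>2 < Re s} \<noteq> {}" by (auto intro!: exI[of _ "of_real (\<sigma>\<^sub>2 + 1)"])
    show "U holomorphic_on R" using U_hol R(4) by (rule holomorphic_on_subset)
  qed (use R F_hol F_eq that in \<open>auto simp: open_halfspace_Re_gt\<close>)
  define e where "e = (l + lam - c) / 4"
  have e: "0 < e" using c by (simp add: e_def)
  have "((\<lambda>\<sigma>. (\<sigma> - \<sigma>\<^sub>0) * (\<bar>c\<bar> / \<bar>t\<^sub>0\<bar>)) \<longlongrightarrow> (\<sigma>\<^sub>0 - \<sigma>\<^sub>0) * (\<bar>c\<bar> / \<bar>t\<^sub>0\<bar>)) (at_right \<sigma>\<^sub>0)"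
    by (intro tendsto_intros)
  hence ev1: "\<forall>\<^sub>F \<sigma> in at_right \<sigma>\<^sub>0. (\<sigma> - \<sigma>\<^sub>0) * (\<bar>c\<bar> / \<bar>t\<^sub>0\<bar>) < e"
    using e by (intro order_tendstoD(2)) auto
  have "\<forall>\<^sub>F \<delta> in at_right 0. ennreal \<delta> * P \<delta> < ennreal (e / 2)"
    using e by (intro order_tendstoD(2)[OF P_lim]) auto
  hence ev2: "\<forall>\<^sub>F \<sigma> in at_right \<sigma>\<^sub>0. ennreal (\<sigma> - \<sigma>\<^sub>0) * P (\<sigma> - \<sigma>\<^sub>0) < ennreal (e / 2)"
    by (subst at_right_to_0) (simp add: eventually_filtermap)
  have ev3: "\<forall>\<^sub>F \<sigma> in at_right \<sigma>\<^sub>0. ereal (l - e) < ereal ((\<sigma> - \<sigma>\<^sub>0) * Re (A (of_real \<sigma>)))"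
    using l e by (intro less_LiminfD) auto
  have "\<forall>\<^sub>F \<sigma> in at_right \<sigma>\<^sub>0. (\<sigma> - \<sigma>\<^sub>0) * norm (A (Complex \<sigma> t\<^sub>0)) \<le> lam - e"
    using ev1 ev2 ev3 t\<^sub>0(2) eventually_at_right_less[of \<sigma>\<^sub>0]
  proof eventually_elim
    case (elim \<sigma>)
    let ?s = "Complex \<sigma> t\<^sub>0"
    have V_ge: "0 \<le> Re (V (of_real \<sigma>))"
      using norm_laplace_le[OF ln_meas(2) AE_v, of "of_real \<sigma>"] by (simp add: V_def order_trans[OF norm_ge_zero])
    have "ennreal ((\<sigma> - \<sigma>\<^sub>0) * Re (V (of_real \<sigma>))) < ennreal (e / 2)"
      using elim(2) V_nn[OF elim(5)] V_ge elim(5) by (simp add: ennreal_mult)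
    hence V_small: "(\<sigma> - \<sigma>\<^sub>0) * Re (V (of_real \<sigma>)) < e / 2"
      using e by (subst (asm) ennreal_less_iff) (use V_ge elim(5) in auto)
    have "norm (of_real c / (?s - of_real \<sigma>\<^sub>0)) \<le> \<bar>c\<bar> / \<bar>t\<^sub>0\<bar>"
      using abs_Im_le_cmod[of "?s - of_real \<sigma>\<^sub>0"] t\<^sub>0(1)
      by (auto simp: norm_divide intro!: divide_left_mono mult_pos_pos)
    moreover have "A ?s = of_real c / (?s - of_real \<sigma>\<^sub>0) + V ?s - U ?s"
      using F_eq_R[OF elim(4)] by (simp add: F_def algebra_simps)
    moreover have "norm (V ?s) \<le> Re (V (of_real \<sigma>))" "norm (U ?s) \<le> Re (U (of_real \<sigma>))"
      using norm_laplace_le[OF ln_meas(2) AE_v, of ?s] norm_laplace_le[OF ln_meas(1) AE_u, of ?s]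
      by (simp_all add: U_def V_def)
    ultimately have "norm (A ?s) \<le> \<bar>c\<bar> / \<bar>t\<^sub>0\<bar> + Re (V (of_real \<sigma>)) + Re (U (of_real \<sigma>))"
      by (metis add_mono norm_triangle_le norm_triangle_le_diff)
    also have "Re (U (of_real \<sigma>)) = c / (\<sigma> - \<sigma>\<^sub>0) - Re (A (of_real \<sigma>)) + Re (V (of_real \<sigma>))"
      unfolding F_eq_R[OF half_line[OF elim(5)], symmetric] F_def by (simp flip: of_real_diff of_real_divide)
    finally have "(\<sigma> - \<sigma>\<^sub>0) * norm (A ?s) \<le>
        (\<sigma> - \<sigma>\<^sub>0) * (\<bar>c\<bar> / \<bar>t\<^sub>0\<bar> + Re (V (of_real \<sigma>)) + (c / (\<sigma> - \<sigma>\<^sub>0) - Re (A (of_real \<sigma>)) + Re (V (of_real \<sigma>))))"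
      using elim(5) by (intro mult_left_mono) auto
    also have "\<dots> = (\<sigma> - \<sigma>\<^sub>0) * (\<bar>c\<bar> / \<bar>t\<^sub>0\<bar>) + 2 * ((\<sigma> - \<sigma>\<^sub>0) * Re (V (of_real \<sigma>))) + c - (\<sigma> - \<sigma>\<^sub>0) * Re (A (of_real \<sigma>))"
    proof -
      have "d * (a + v + (c / d - r + v)) = d * a + 2 * (d * v) + c - d * r" if "d \<noteq> 0" for a d r v :: real
        using that by (simp add: field_simps)
      thus ?thesis using elim(5) by simp
    qed
    also have "\<dots> \<le> e + e + c - (l - e)" using elim(1,3) V_small by simp
    also have "\<dots> = lam - e" by (simp add: e_def field_simps)
    finally show ?case .
  qed
  hence "ereal lam \<le> ereal (lam - e)"
    unfolding lam[symmetric] by (intro Limsup_bounded) (auto elim: eventually_mono)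
  thus False using e by simp
qed

section \<open>Integrals over short windows\<close>

text \<open>
  Every \<open>u > 2 T\<close> lies in the windows \<open>{x..2 * x}\<close> with \<open>u / 2 \<le> x \<le> u\<close>, all of them with \<open>x \<ge> T\<close>, and
  these \<open>x\<close> have total weight \<open>ln 2\<close> with respect to \<open>dx / x\<close>. Tonelli's theorem does the rest.
\<close>

lemma nn_integral_dyadic_average:
  fixes f :: "real \<Rightarrow> ennreal"
  assumes [measurable]: "f \<in> borel_measurable borel" and T: "0 < T"
  shows "ennreal (ln 2) * (\<integral>\<^sup>+u\<in>{2 * T<..}. f u \<partial>lborel)
       \<le> (\<integral>\<^sup>+x\<in>{T..}. ennreal (1 / x) * (\<integral>\<^sup>+u\<in>{x..2 * x}. f u \<partial>lborel) \<partial>lborel)"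
proof -
  have log2: "ennreal (ln 2) \<le> (\<integral>\<^sup>+x. ennreal (1 / x) * indicator {T..} x * indicator {x..2 * x} u \<partial>lborel)"
    if u: "2 * T < u" for u
  proof -
    have "(\<integral>\<^sup>+x. ennreal (1 / x) * indicator {u / 2..u} x \<partial>lborel) = ln u - ln (u / 2)"
      using u T by (intro nn_integral_FTC_Icc) (auto intro!: derivative_eq_intros)
    also have "ln u - ln (u / 2) = ln 2" using u T by (simp add: ln_div)
    finally have "ennreal (ln 2) = (\<integral>\<^sup>+x. ennreal (1 / x) * indicator {u / 2..u} x \<partial>lborel)" by simp
    also have "\<dots> \<le> (\<integral>\<^sup>+x. ennreal (1 / x) * indicator {T..} x * indicator {x..2 * x} u \<partial>lborel)"
      using u by (intro nn_integral_mono) (auto simp: indicator_def)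
    finally show ?thesis .
  qed
  have "ennreal (ln 2) * (\<integral>\<^sup>+u\<in>{2 * T<..}. f u \<partial>lborel)
      = (\<integral>\<^sup>+u. ennreal (ln 2) * (f u * indicator {2 * T<..} u) \<partial>lborel)"
    by (subst nn_integral_cmult) auto
  also have "\<dots> \<le> (\<integral>\<^sup>+u. (\<integral>\<^sup>+x. ennreal (1 / x) * indicator {T..} x * indicator {x..2 * x} u \<partial>lborel) * f u \<partial>lborel)"
    using log2 by (intro nn_integral_mono) (auto simp: indicator_def mult_right_mono)
  also have "\<dots> = (\<integral>\<^sup>+u. (\<integral>\<^sup>+x. ennreal (1 / x) * indicator {T..} x * (if x \<le> u \<and> u \<le> 2 * x then 1 else 0) * f u \<partial>lborel) \<partial>lborel)"
    by (subst nn_integral_multc [symmetric]) (auto simp: indicator_def intro!: nn_integral_cong)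
  also have "\<dots> = (\<integral>\<^sup>+x. (\<integral>\<^sup>+u. ennreal (1 / x) * indicator {T..} x * (if x \<le> u \<and> u \<le> 2 * x then 1 else 0) * f u \<partial>lborel) \<partial>lborel)"
    by (rule lborel_pair.Fubini') measurable
  also have "\<dots> = (\<integral>\<^sup>+x\<in>{T..}. ennreal (1 / x) * (\<integral>\<^sup>+u\<in>{x..2 * x}. f u \<partial>lborel) \<partial>lborel)"
    by (intro nn_integral_cong) (subst nn_integral_cmult [symmetric], measurable, auto simp: indicator_def mult_ac intro!: nn_integral_cong)
  finally show ?thesis .
qed

lemma weighted_am_gm:
  fixes \<kappa> X Y :: real
  assumes "0 < \<kappa>"
  shows "X * Y \<le> \<kappa> / 2 * X\<^sup>2 + Y\<^sup>2 / (2 * \<kappa>)"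
proof -
  have "0 \<le> (\<kappa> * X - Y)\<^sup>2 / (2 * \<kappa>)" using assms by simp
  also have "\<dots> = \<kappa> / 2 * X\<^sup>2 + Y\<^sup>2 / (2 * \<kappa>) - X * Y"
    using assms by (simp add: power2_eq_square field_simps)
  finally show ?thesis by simp
qed

lemma nn_integral_powr_atLeast_1:
  assumes "0 < \<delta>"
  shows "(\<integral>\<^sup>+x\<in>{1..}. ennreal (x powr (- \<delta> - 1)) \<partial>lborel) = ennreal (1 / \<delta>)"
proof -
  have "(\<integral>\<^sup>+x. ennreal (x powr (- \<delta> - 1)) * indicator {1..} x \<partial>lborel) = 0 - (- (1 powr (- \<delta>)) / \<delta>)"
  proof (rule nn_integral_FTC_atLeast)
    show "((\<lambda>x. - (x powr (- \<delta>)) / \<delta>) \<longlongrightarrow> 0) at_top"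
    proof -
      have "((\<lambda>x::real. x powr (- \<delta>)) \<longlongrightarrow> 0) at_top"
        using assms by (intro tendsto_neg_powr filterlim_ident) auto
      from tendsto_divide[OF tendsto_minus[OF this] tendsto_const[of \<delta>]] assms
      show ?thesis by simp
    qed
  qed (use assms in \<open>auto intro!: derivative_eq_intros\<close>)
  thus ?thesis by simp
qed

context
  fixes \<Delta> h :: "real \<Rightarrow> real" and B :: "real set" and \<sigma>\<^sub>0 K :: real
  assumes \<Delta>_meas [measurable]: "\<Delta> \<in> borel_measurable borel"
    and B_meas [measurable]: "B \<in> sets borel"
    and B_sub: "B \<subseteq> {1..}"
    and h_meas: "h \<in> borel_measurable (lebesgue_on {1..})"
    and h_pos: "\<And>x. 1 \<le> x \<Longrightarrow> 0 < h x"
    and K: "0 < K"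
begin

text \<open>
  The Cauchy-Schwarz step, in the form of a weighted arithmetic-geometric mean inequality: the mean
  square bounds one factor, the measure of \<open>B\<close> in the window the other. The weight depends on \<open>x\<close> so that
  the mean-square part becomes \<open>\<eta> / 2 * x powr (- \<delta> - 1)\<close>, whose integral is \<open>\<eta> / (2 \<delta>)\<close>, and the other part
  becomes a multiple of the integrand that the main result is about. A free \<open>\<eta>\<close> is enough to detect
  \<open>o (1 / \<delta>)\<close>.
\<close>

lemma window_bound:
  assumes x: "1 \<le> x" and \<eta>: "0 < \<eta>" and \<delta>: "0 < \<delta>"
    and mean_sq: "(\<integral>\<^sup>+u\<in>{x..2 * x} \<inter> B. ennreal ((\<Delta> u)\<^sup>2 / u powr (2 * \<sigma>\<^sub>0 + 1)) \<partial>lborel) \<le> ennreal (K * h x)"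
  shows "ennreal (1 / x) * (\<integral>\<^sup>+u\<in>{x..2 * x}. ennreal (\<Delta> u * u powr (- (\<sigma>\<^sub>0 + \<delta>) - 1)) * indicator B u \<partial>lborel)
    \<le> ennreal (\<eta> / 2) * ennreal (x powr (- \<delta> - 1))
      + ennreal (K / (2 * \<eta>)) * (emeasure lborel (B \<inter> {x..2 * x}) * ennreal (h x / x powr (2 + \<delta>)))"
proof -
  \<comment> \<open>This weight makes \<open>\<kappa> K (h x)\<close> equal to \<open>\<eta> x powr (- \<delta>)\<close>.\<close>
  define \<kappa> where "\<kappa> = \<eta> * x powr (- \<delta>) / (K * h x)"
  have hx: "0 < h x" using h_pos x by simp
  have \<kappa>: "0 < \<kappa>" using \<eta> K hx x by (simp add: \<kappa>_def)
  define b where "b = x powr (- 1 - 2 * \<delta>) / (2 * \<kappa>)"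
  have b: "0 \<le> b" using \<kappa> by (simp add: b_def)
  have pointwise: "ennreal (\<Delta> u * u powr (- (\<sigma>\<^sub>0 + \<delta>) - 1)) \<le>
      ennreal (\<kappa> / 2) * ennreal ((\<Delta> u)\<^sup>2 / u powr (2 * \<sigma>\<^sub>0 + 1)) + ennreal b"
    if u: "x \<le> u" for u
  proof -
    define X Y where "X = \<Delta> u * u powr (- \<sigma>\<^sub>0 - 1 / 2)" and "Y = u powr (- 1 / 2 - \<delta>)"
    have u1: "1 \<le> u" using u x by simp
    have "\<Delta> u * u powr (- (\<sigma>\<^sub>0 + \<delta>) - 1) = X * Y"
      by (simp add: X_def Y_def mult.assoc powr_add [symmetric])
    also have "\<dots> \<le> \<kappa> / 2 * X\<^sup>2 + Y\<^sup>2 / (2 * \<kappa>)" using \<kappa> by (rule weighted_am_gm)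
    also have "X\<^sup>2 = (\<Delta> u)\<^sup>2 / u powr (2 * \<sigma>\<^sub>0 + 1)"
    proof -
      have "(u powr (- \<sigma>\<^sub>0 - 1 / 2))\<^sup>2 = u powr (- (2 * \<sigma>\<^sub>0 + 1))"
        by (simp add: power2_eq_square powr_add [symmetric])
      thus ?thesis using u1 by (simp only: X_def power_mult_distrib powr_minus divide_inverse)
    qed
    also have "Y\<^sup>2 / (2 * \<kappa>) \<le> b"
    proof -
      have "Y\<^sup>2 = u powr (- 1 - 2 * \<delta>)"
        by (simp add: Y_def power2_eq_square powr_add [symmetric])
      also have "\<dots> \<le> x powr (- 1 - 2 * \<delta>)" using u x \<delta> by (intro powr_mono2') auto
      finally show ?thesis unfolding b_def using \<kappa> by (intro divide_right_mono) auto
    qed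
    finally show ?thesis using \<kappa> b
      by (simp flip: ennreal_mult ennreal_plus) 
  qed
  have "(\<integral>\<^sup>+u\<in>{x..2 * x}. ennreal (\<Delta> u * u powr (- (\<sigma>\<^sub>0 + \<delta>) - 1)) * indicator B u \<partial>lborel)
     \<le> (\<integral>\<^sup>+u. ennreal (\<kappa> / 2) * (ennreal ((\<Delta> u)\<^sup>2 / u powr (2 * \<sigma>\<^sub>0 + 1)) * indicator ({x..2 * x} \<inter> B) u)
            + ennreal b * indicator (B \<inter> {x..2 * x}) u \<partial>lborel)"
    using pointwise by (intro nn_integral_mono) (auto simp: indicator_def)
  also have "\<dots> = ennreal (\<kappa> / 2) * (\<integral>\<^sup>+u\<in>{x..2 * x} \<inter> B. ennreal ((\<Delta> u)\<^sup>2 / u powr (2 * \<sigma>\<^sub>0 + 1)) \<partial>lborel)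
            + ennreal b * emeasure lborel (B \<inter> {x..2 * x})"
    by (simp add: nn_integral_add nn_integral_cmult)
  also have "\<dots> \<le> ennreal (\<kappa> / 2) * ennreal (K * h x) + ennreal b * emeasure lborel (B \<inter> {x..2 * x})"
    using mean_sq by (intro add_mono mult_left_mono) auto
  finally have "ennreal (1 / x) * (\<integral>\<^sup>+u\<in>{x..2 * x}. ennreal (\<Delta> u * u powr (- (\<sigma>\<^sub>0 + \<delta>) - 1)) * indicator B u \<partial>lborel)
     \<le> ennreal (1 / x) * (ennreal (\<kappa> / 2) * ennreal (K * h x) + ennreal b * emeasure lborel (B \<inter> {x..2 * x}))"
    by (rule mult_left_mono) simp
  also have "\<dots> = ennreal (1 / x * (\<kappa> / 2 * (K * h x))) + ennreal (1 / x * b) * emeasure lborel (B \<inter> {x..2 * x})"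
  proof -
    have "ennreal (1 / x * (\<kappa> / 2 * (K * h x))) = ennreal (1 / x) * (ennreal (\<kappa> / 2) * ennreal (K * h x))"
      using x \<kappa> by (subst ennreal_mult', simp, subst ennreal_mult', simp_all)
    moreover have "ennreal (1 / x * b) = ennreal (1 / x) * ennreal b"
      using x by (intro ennreal_mult') simp
    ultimately show ?thesis by (simp only: distrib_left mult.assoc)
  qed
  also have "1 / x * (\<kappa> / 2 * (K * h x)) = \<eta> / 2 * x powr (- \<delta> - 1)"
    using x K hx by (simp add: \<kappa>_def powr_diff)
  also have "1 / x * b = K / (2 * \<eta>) * (h x / x powr (2 + \<delta>))"
  proof -
    have "- 1 - 2 * \<delta> = - 1 + - \<delta> + - \<delta>" by simp
    hence "x powr (- 1 - 2 * \<delta>) = x powr (- 1) * x powr (- \<delta>) * x powr (- \<delta>)"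
      by (simp only: powr_add)
    hence e1: "x powr (- 1 - 2 * \<delta>) = 1 / (x * x powr \<delta> * x powr \<delta>)"
      using x by (simp add: powr_minus_divide)
    have e2: "x powr (2 + \<delta>) = x * x * x powr \<delta>"
      using x by (simp add: powr_add power2_eq_square)
    have "1 / a * (1 / (a * y * y) / (2 * (\<eta> * (1 / y) / (K * H)))) = K / (2 * \<eta>) * (H / (a * a * y))"
      if "0 < a" "0 < y" "0 < H" for a y H :: real
      using that \<eta> K by (simp add: field_simps)
    from this[of x "x powr \<delta>" "h x"] show ?thesis
      unfolding b_def \<kappa>_def e1 e2 powr_minus_divide[of x \<delta>] using x hx by simp
  qed
  also have "ennreal (\<eta> / 2 * x powr (- \<delta> - 1)) = ennreal (\<eta> / 2) * ennreal (x powr (- \<delta> - 1))"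
    using \<eta> by (intro ennreal_mult') simp
  also have "ennreal (K / (2 * \<eta>) * (h x / x powr (2 + \<delta>))) = ennreal (K / (2 * \<eta>)) * ennreal (h x / x powr (2 + \<delta>))"
    using \<eta> K by (intro ennreal_mult') simp
  finally show ?thesis
    by (simp only: mult.assoc mult.commute[of _ "emeasure _ _"] mult.left_commute[of _ "emeasure _ _"])
qed

text \<open>
  The mean-square hypothesis holds only for \<open>x \<ge> T\<close>. The windows that start there may give a point \<open>u \<le> 2 T\<close>
  less than the weight \<open>ln 2\<close>; the contribution of these points is bounded uniformly in \<open>\<delta>\<close> by the first summand.
\<close>

lemma excess_integral_bound:
  assumes T: "1 \<le> T" and \<eta>: "0 < \<eta>" and \<delta>: "0 < \<delta>"
    and mean_sq: "\<And>x. T \<le> x \<Longrightarrow>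
      (\<integral>\<^sup>+u\<in>{x..2 * x} \<inter> B. ennreal ((\<Delta> u)\<^sup>2 / u powr (2 * \<sigma>\<^sub>0 + 1)) \<partial>lborel) \<le> ennreal (K * h x)"
  shows "(\<integral>\<^sup>+u\<in>B. ennreal (\<Delta> u * u powr (- (\<sigma>\<^sub>0 + \<delta>) - 1)) \<partial>lborel)
    \<le> (\<integral>\<^sup>+u\<in>{1..2 * T}. ennreal (\<bar>\<Delta> u\<bar> * u powr (- \<sigma>\<^sub>0 - 1)) \<partial>lborel)
      + ennreal (1 / ln 2) * (ennreal (\<eta> / (2 * \<delta>))
         + ennreal (K / (2 * \<eta>)) * (\<integral>\<^sup>+x\<in>{1..}. emeasure lborel (B \<inter> {x..2 * x}) * ennreal (h x / x powr (2 + \<delta>)) \<partial>lebesgue))"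
proof -
  define f where "f u = ennreal (\<Delta> u * u powr (- (\<sigma>\<^sub>0 + \<delta>) - 1)) * indicator B u" for u
  have f_meas [measurable]: "f \<in> borel_measurable borel" unfolding f_def by measurable
  define E where "E x = emeasure lborel (B \<inter> {x..2 * x})" for x
  have "(\<lambda>x. \<integral>\<^sup>+u. indicator B u * (if x \<le> u \<and> u \<le> 2 * x then 1 else 0) \<partial>lborel) \<in> borel_measurable borel"
    by measurable
  also have "(\<lambda>x. \<integral>\<^sup>+u. indicator B u * (if x \<le> u \<and> u \<le> 2 * x then 1 else 0) \<partial>lborel) = E"
  proof
    fix x
    have "(\<integral>\<^sup>+u. indicator B u * (if x \<le> u \<and> u \<le> 2 * x then 1 else 0) \<partial>lborel)
        = (\<integral>\<^sup>+u. indicator (B \<inter> {x..2 * x}) u \<partial>lborel)"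
      by (intro nn_integral_cong) (auto simp: indicator_def)
    also have "\<dots> = E x" by (simp add: E_def)
    finally show "(\<integral>\<^sup>+u. indicator B u * (if x \<le> u \<and> u \<le> 2 * x then 1 else 0) \<partial>lborel) = E x" .
  qed
  finally have "E \<in> borel_measurable borel" .
  hence E_meas [measurable]: "E \<in> borel_measurable lebesgue" by (intro measurable_completion) simp
  have h_ind: "(\<lambda>x. indicator {1..} x *\<^sub>R h x) \<in> borel_measurable lebesgue"
    using h_meas by (subst (asm) borel_measurable_restrict_space_iff) auto
  have hE_meas: "(\<lambda>x. E x * ennreal (h x / x powr (2 + \<delta>)) * indicator {1..} x) \<in> borel_measurable lebesgue"
  proof -
    have "(\<lambda>x. E x * ennreal (indicator {1..} x *\<^sub>R h x / x powr (2 + \<delta>))) \<in> borel_measurable lebesgue"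
    proof (intro borel_measurable_times_ennreal E_meas measurable_compose[OF _ measurable_ennreal]
        borel_measurable_divide h_ind)
      show "(\<lambda>x. x powr (2 + \<delta>)) \<in> borel_measurable lebesgue"
        by (rule measurable_completion) measurable
    qed
    also have "(\<lambda>x. E x * ennreal (indicator {1..} x *\<^sub>R h x / x powr (2 + \<delta>)))
        = (\<lambda>x. E x * ennreal (h x / x powr (2 + \<delta>)) * indicator {1..} x)"
      by (auto simp: indicator_def)
    finally show ?thesis .
  qed
  have "ennreal (ln 2) * (\<integral>\<^sup>+u\<in>{2 * T<..}. f u \<partial>lborel)
      \<le> (\<integral>\<^sup>+x\<in>{T..}. ennreal (1 / x) * (\<integral>\<^sup>+u\<in>{x..2 * x}. f u \<partial>lborel) \<partial>lborel)"
    using T by (intro nn_integral_dyadic_average) auto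
  also have "\<dots> \<le> (\<integral>\<^sup>+x. ennreal (\<eta> / 2) * (ennreal (x powr (- \<delta> - 1)) * indicator {1..} x)
        + ennreal (K / (2 * \<eta>)) * (E x * ennreal (h x / x powr (2 + \<delta>)) * indicator {1..} x) \<partial>lborel)"
  proof (rule nn_integral_mono)
    fix x :: real
    show "ennreal (1 / x) * (\<integral>\<^sup>+u\<in>{x..2 * x}. f u \<partial>lborel) * indicator {T..} x
        \<le> ennreal (\<eta> / 2) * (ennreal (x powr (- \<delta> - 1)) * indicator {1..} x)
        + ennreal (K / (2 * \<eta>)) * (E x * ennreal (h x / x powr (2 + \<delta>)) * indicator {1..} x)"
    proof (cases "T \<le> x")
      case True
      with T window_bound[OF _ \<eta> \<delta> mean_sq[OF True]] show ?thesis by (simp add: f_def E_def)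
    qed simp
  qed
  also have "\<dots> = (\<integral>\<^sup>+x. ennreal (\<eta> / 2) * (ennreal (x powr (- \<delta> - 1)) * indicator {1..} x)
        + ennreal (K / (2 * \<eta>)) * (E x * ennreal (h x / x powr (2 + \<delta>)) * indicator {1..} x) \<partial>lebesgue)"
    by (rule nn_integral_completion [symmetric])
  also have "\<dots> = ennreal (\<eta> / 2) * (\<integral>\<^sup>+x\<in>{1..}. ennreal (x powr (- \<delta> - 1)) \<partial>lebesgue)
        + ennreal (K / (2 * \<eta>)) * (\<integral>\<^sup>+x\<in>{1..}. E x * ennreal (h x / x powr (2 + \<delta>)) \<partial>lebesgue)"
  proof -
    have m: "(\<lambda>x::real. ennreal (x powr (- \<delta> - 1)) * indicator {1..} x) \<in> borel_measurable lebesgue"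
      by (rule measurable_completion) measurable
    show ?thesis
      using hE_meas m by (subst nn_integral_add) (auto simp: nn_integral_cmult)
  qed
  also have "(\<integral>\<^sup>+x\<in>{1..}. ennreal (x powr (- \<delta> - 1)) \<partial>lebesgue) = ennreal (1 / \<delta>)"
    using nn_integral_powr_atLeast_1[OF \<delta>] by (simp only: nn_integral_completion)
  also have "ennreal (\<eta> / 2) * ennreal (1 / \<delta>) = ennreal (\<eta> / (2 * \<delta>))"
    using \<eta> \<delta> by (simp flip: ennreal_mult)
  finally have "ennreal (1 / ln 2) * (ennreal (ln 2) * (\<integral>\<^sup>+u\<in>{2 * T<..}. f u \<partial>lborel))
      \<le> ennreal (1 / ln 2) * (ennreal (\<eta> / (2 * \<delta>))
         + ennreal (K / (2 * \<eta>)) * (\<integral>\<^sup>+x\<in>{1..}. E x * ennreal (h x / x powr (2 + \<delta>)) \<partial>lebesgue))"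
    by (rule mult_left_mono) simp
  moreover have "ennreal (1 / ln 2) * (ennreal (ln 2) * z) = z" for z
    by (simp add: mult.assoc [symmetric] ennreal_mult [symmetric])
  ultimately have tail: "(\<integral>\<^sup>+u\<in>{2 * T<..}. f u \<partial>lborel) \<le> ennreal (1 / ln 2) * (ennreal (\<eta> / (2 * \<delta>))
         + ennreal (K / (2 * \<eta>)) * (\<integral>\<^sup>+x\<in>{1..}. E x * ennreal (h x / x powr (2 + \<delta>)) \<partial>lebesgue))"
    by simp
  have "(\<integral>\<^sup>+u. f u \<partial>lborel) = (\<integral>\<^sup>+u. f u * indicator {..2 * T} u + f u * indicator {2 * T<..} u \<partial>lborel)"
    by (intro nn_integral_cong) (auto simp: indicator_def)
  also have "\<dots> = (\<integral>\<^sup>+u\<in>{..2 * T}. f u \<partial>lborel) + (\<integral>\<^sup>+u\<in>{2 * T<..}. f u \<partial>lborel)"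
    by (intro nn_integral_add) auto
  finally have split: "(\<integral>\<^sup>+u. f u \<partial>lborel) = (\<integral>\<^sup>+u\<in>{..2 * T}. f u \<partial>lborel) + (\<integral>\<^sup>+u\<in>{2 * T<..}. f u \<partial>lborel)" .
  have head: "(\<integral>\<^sup>+u\<in>{..2 * T}. f u \<partial>lborel) \<le> (\<integral>\<^sup>+u\<in>{1..2 * T}. ennreal (\<bar>\<Delta> u\<bar> * u powr (- \<sigma>\<^sub>0 - 1)) \<partial>lborel)"
  proof (rule nn_integral_mono)
    fix u :: real
    have "\<Delta> u * u powr (- (\<sigma>\<^sub>0 + \<delta>) - 1) \<le> \<bar>\<Delta> u\<bar> * u powr (- \<sigma>\<^sub>0 - 1)" if "1 \<le> u"
      using that \<delta> by (intro mult_mono powr_mono) auto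
    thus "f u * indicator {..2 * T} u \<le> ennreal (\<bar>\<Delta> u\<bar> * u powr (- \<sigma>\<^sub>0 - 1)) * indicator {1..2 * T} u"
      using B_sub by (auto simp: f_def indicator_def intro!: ennreal_leI)
  qed
  have "integral\<^sup>N lborel f = (\<integral>\<^sup>+u\<in>B. ennreal (\<Delta> u * u powr (- (\<sigma>\<^sub>0 + \<delta>) - 1)) \<partial>lborel)"
    by (rule nn_integral_cong) (simp only: f_def)
  thus ?thesis using add_mono[OF head tail] unfolding split[symmetric] by (simp only: E_def)
qed

end

section \<open>The Omega result\<close>

lemma not_omega_inverse_at_0:
  assumes "\<not> omega_inverse_at_0 F"
  shows "((\<lambda>\<delta>. ennreal \<delta> * F \<delta>) \<longlongrightarrow> 0) (at_right 0)"
proof (rule order_tendstoI)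
  fix y :: ennreal assume "0 < y"
  moreover have "Limsup (at_right 0) (\<lambda>\<delta>. ennreal \<delta> * F \<delta>) = 0"
    using assms by (simp add: omega_inverse_at_0_def)
  ultimately show "\<forall>\<^sub>F \<delta> in at_right 0. ennreal \<delta> * F \<delta> < y" by (intro Limsup_lessD) simp
qed simp

context
  fixes \<Delta> :: "real \<Rightarrow> real" and \<sigma>\<^sub>2 :: real
  assumes \<Delta>_meas [measurable]: "\<Delta> \<in> borel_measurable borel"
    and growth: "\<And>\<sigma>. \<sigma>\<^sub>2 < \<sigma> \<Longrightarrow> 0 \<le> \<sigma> \<Longrightarrow> \<exists>C. \<forall>x\<ge>1. \<bar>\<Delta> x\<bar> \<le> C * x powr \<sigma>"
begin

lemma set_integrable_of_growth:
  assumes "0 \<le> \<sigma>\<^sub>2" "\<sigma>\<^sub>2 < \<sigma>"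
  shows "set_integrable lborel {1..} (\<lambda>x. \<Delta> x * x powr (- \<sigma> - 1))"
proof -
  define \<sigma>' where "\<sigma>' = (\<sigma> + \<sigma>\<^sub>2) / 2"
  have \<sigma>': "\<sigma>\<^sub>2 < \<sigma>'" "0 \<le> \<sigma>'" "0 < \<sigma> - \<sigma>'" using assms by (simp_all add: \<sigma>'_def field_simps)
  obtain C where C: "\<forall>x\<ge>1. \<bar>\<Delta> x\<bar> \<le> C * x powr \<sigma>'" using growth[OF \<sigma>'(1,2)] by blast
  have "integrable lborel (\<lambda>x. indicator {1..} x *\<^sub>R x powr (- (\<sigma> - \<sigma>') - 1))"
  proof (rule integrableI_nonneg)
    have "(\<integral>\<^sup>+x. ennreal (indicator {1..} x *\<^sub>R x powr (- (\<sigma> - \<sigma>') - 1)) \<partial>lborel)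
        = (\<integral>\<^sup>+x\<in>{1..}. ennreal (x powr (- (\<sigma> - \<sigma>') - 1)) \<partial>lborel)"
      by (intro nn_integral_cong) (auto simp: indicator_def)
    thus "(\<integral>\<^sup>+x. ennreal (indicator {1..} x *\<^sub>R x powr (- (\<sigma> - \<sigma>') - 1)) \<partial>lborel) < \<infinity>"
      by (simp only: nn_integral_powr_atLeast_1[OF \<sigma>'(3)]) simp
  qed auto
  hence "integrable lborel (\<lambda>x. C * (indicator {1..} x *\<^sub>R x powr (- (\<sigma> - \<sigma>') - 1)))"
    by (rule integrable_mult_right)
  thus ?thesis unfolding set_integrable_def
  proof (rule Bochner_Integration.integrable_bound)
    have "\<bar>\<Delta> x\<bar> * x powr (- \<sigma> - 1) \<le> C * x powr (- (\<sigma> - \<sigma>') - 1)" if "1 \<le> x" for x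
    proof -
      have "\<bar>\<Delta> x\<bar> * x powr (- \<sigma> - 1) \<le> C * x powr \<sigma>' * x powr (- \<sigma> - 1)"
        using C that by (intro mult_right_mono) auto
      also have "\<dots> = C * (x powr \<sigma>' * x powr (- \<sigma> - 1))" by (rule mult.assoc)
      also have "x powr \<sigma>' * x powr (- \<sigma> - 1) = x powr (- (\<sigma> - \<sigma>') - 1)"
        by (subst powr_add [symmetric]) (simp add: algebra_simps)
      finally show ?thesis .
    qed
    note bound = this
    show "AE x in lborel. norm (indicator {1..} x *\<^sub>R (\<Delta> x * x powr (- \<sigma> - 1)))
        \<le> norm (C * (indicator {1..} x *\<^sub>R x powr (- (\<sigma> - \<sigma>') - 1)))"
    proof (rule AE_I2)
      fix x :: real
      show "norm (indicator {1..} x *\<^sub>R (\<Delta> x * x powr (- \<sigma> - 1)))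
          \<le> norm (C * (indicator {1..} x *\<^sub>R x powr (- (\<sigma> - \<sigma>') - 1)))"
      proof (cases "1 \<le> x")
        case True
        have "\<bar>\<Delta> x\<bar> * x powr (- \<sigma> - 1) \<le> \<bar>C * x powr (- (\<sigma> - \<sigma>') - 1)\<bar>"
          by (rule order_trans[OF bound[OF True] abs_ge_self])
        thus ?thesis using True by (simp add: abs_mult)
      qed simp
    qed
  qed simp
qed

lemma locally_bounded_of_growth: "\<exists>M\<ge>0. \<forall>x\<in>{1..T}. \<bar>\<Delta> x\<bar> \<le> M"
proof -
  define \<sigma> where "\<sigma> = \<bar>\<sigma>\<^sub>2\<bar> + 1"
  have \<sigma>: "\<sigma>\<^sub>2 < \<sigma>" "0 \<le> \<sigma>" by (simp_all add: \<sigma>_def)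
  obtain C where C: "\<forall>x\<ge>1. \<bar>\<Delta> x\<bar> \<le> C * x powr \<sigma>" using growth[OF \<sigma>] by blast
  have "0 \<le> C" using C[rule_format, of 1] by simp
  hence "\<bar>\<Delta> x\<bar> \<le> C * T powr \<sigma>" if "x \<in> {1..T}" for x
    using that \<sigma>(2) by (intro order_trans[OF C[rule_format, of x]] mult_left_mono powr_mono2) auto
  with \<open>0 \<le> C\<close> show ?thesis by (intro exI[of _ "C * T powr \<sigma>"]) auto
qed

lemma mean_square_window:
  assumes [measurable]: "B \<in> sets borel" and T: "1 \<le> T" and \<sigma>\<^sub>0: "0 \<le> \<sigma>\<^sub>0"
  shows "(\<integral>\<^sup>+u\<in>{T..2 * T} \<inter> B. ennreal ((\<Delta> u)\<^sup>2 / u powr (2 * \<sigma>\<^sub>0 + 1)) \<partial>lborel)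
       = ennreal (LINT u:{T..2 * T} \<inter> B|lebesgue. (\<Delta> u)\<^sup>2 / u powr (2 * \<sigma>\<^sub>0 + 1))"
proof -
  define g where "g = (\<lambda>u. indicator ({T..2 * T} \<inter> B) u *\<^sub>R ((\<Delta> u)\<^sup>2 / u powr (2 * \<sigma>\<^sub>0 + 1)))"
  have [measurable]: "g \<in> borel_measurable borel" unfolding g_def by measurable
  obtain M where M: "0 \<le> M" "\<forall>x\<in>{1..2 * T}. \<bar>\<Delta> x\<bar> \<le> M" using locally_bounded_of_growth by blast
  have g_bound: "norm (g u) \<le> norm (M\<^sup>2 * indicator {T..2 * T} u)" for u
  proof (cases "u \<in> {T..2 * T} \<inter> B")
    case True
    hence u: "1 \<le> u" "u \<le> 2 * T" using T by auto
    hence "\<bar>\<Delta> u\<bar>\<^sup>2 \<le> M\<^sup>2" using M by (intro power_mono) auto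
    moreover have "1 \<le> u powr (2 * \<sigma>\<^sub>0 + 1)" using u \<sigma>\<^sub>0 by (intro ge_one_powr_ge_zero) auto
    ultimately have "(\<Delta> u)\<^sup>2 / u powr (2 * \<sigma>\<^sub>0 + 1) \<le> M\<^sup>2 / 1" by (intro frac_le) auto
    thus ?thesis using True by (simp add: g_def)
  qed (simp add: g_def)
  have "integrable lborel (\<lambda>u. M\<^sup>2 * indicator {T..2 * T} u)"
    using T by (intro integrable_mult_right) (simp add: integrable_indicator_iff)
  hence int: "integrable lborel g"
    by (rule Bochner_Integration.integrable_bound) (use g_bound in auto)
  have "(\<integral>\<^sup>+u\<in>{T..2 * T} \<inter> B. ennreal ((\<Delta> u)\<^sup>2 / u powr (2 * \<sigma>\<^sub>0 + 1)) \<partial>lborel) = (\<integral>\<^sup>+u. ennreal (g u) \<partial>lborel)"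
    by (intro nn_integral_cong) (auto simp: g_def indicator_def)
  also have "\<dots> = ennreal (integral\<^sup>L lborel g)"
    by (rule nn_integral_eq_integral[OF int]) (auto simp: g_def)
  also have "integral\<^sup>L lborel g = integral\<^sup>L lebesgue g"
    by (rule integral_completion [symmetric]) simp
  finally show ?thesis by (simp only: g_def set_lebesgue_integral_def)
qed

text \<open>
  On \<open>B\<close> the excess \<open>\<Delta> x - c x powr \<sigma>\<^sub>0\<close> is at most \<open>\<Delta> x\<close>, as \<open>c \<ge> 0\<close>, and off \<open>B\<close> it has no positive part.
  So the bound on the integral of \<open>\<Delta>\<close> over \<open>B\<close> also bounds the excess integral. If the window integral
  were \<open>o (1 / \<delta>)\<close>, then, after multiplication by \<open>\<delta>\<close>, this bound would tend to \<open>\<eta> / (2 ln 2)\<close> for every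
  \<open>\<eta> > 0\<close>, and the excess integral would be \<open>o (1 / \<delta>)\<close> too.
\<close>

theorem excess_set_omega:
  fixes A :: "complex \<Rightarrow> complex" and h :: "real \<Rightarrow> real" and c lam l :: real
  assumes A: "continues_in_half_plane \<sigma>\<^sub>0 \<sigma>\<^sub>2 (error_mellin \<Delta>) A R"
    and \<sigma>\<^sub>0: "0 < \<sigma>\<^sub>0" "\<sigma>\<^sub>0 < \<sigma>\<^sub>2"
    and half_line: "\<And>\<sigma>. \<sigma>\<^sub>0 < \<sigma> \<Longrightarrow> of_real \<sigma> \<in> R"
    and t\<^sub>0: "t\<^sub>0 \<noteq> 0" "\<forall>\<^sub>F \<sigma> in at_right \<sigma>\<^sub>0. Complex \<sigma> t\<^sub>0 \<in> R"
    and lam: "Limsup (at_right \<sigma>\<^sub>0) (\<lambda>\<sigma>. ereal ((\<sigma> - \<sigma>\<^sub>0) * norm (A (Complex \<sigma> t\<^sub>0)))) = ereal lam"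
    and l: "Liminf (at_right \<sigma>\<^sub>0) (\<lambda>\<sigma>. ereal ((\<sigma> - \<sigma>\<^sub>0) * Re (A (of_real \<sigma>)))) = ereal l"
    and c: "0 \<le> c" "c < l + lam"
    and B: "B = {x \<in> {1..}. \<Delta> x > c * x powr \<sigma>\<^sub>0}"
    and h_meas: "h \<in> borel_measurable (lebesgue_on {1..})"
    and h_pos: "\<And>x. 1 \<le> x \<Longrightarrow> 0 < h x"
    and h: "(\<lambda>T. LINT x:{T..2 * T} \<inter> B|lebesgue. (\<Delta> x)\<^sup>2 / x powr (2 * \<sigma>\<^sub>0 + 1)) \<in> O[at_top](h)"
  shows "omega_inverse_at_0 (\<lambda>\<delta>. \<integral>\<^sup>+x\<in>{1..}.
           emeasure lebesgue (B \<inter> {x..2 * x}) * ennreal (h x / x powr (2 + \<delta>)) \<partial>lebesgue)"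
proof (rule ccontr)
  define F where "F \<delta> = (\<integral>\<^sup>+x\<in>{1..}. emeasure lborel (B \<inter> {x..2 * x}) * ennreal (h x / x powr (2 + \<delta>)) \<partial>lebesgue)" for \<delta>
  define P where "P \<delta> = (\<integral>\<^sup>+x\<in>{1..}. ennreal ((\<Delta> x - c * x powr \<sigma>\<^sub>0) * x powr (- (\<sigma>\<^sub>0 + \<delta>) - 1)) \<partial>lborel)" for \<delta>
  have "B = {x. 1 \<le> x \<and> c * x powr \<sigma>\<^sub>0 < \<Delta> x}" by (auto simp: B)
  also have "\<dots> \<in> sets borel" by measurable
  finally have B_meas [measurable]: "B \<in> sets borel" .
  have "emeasure lebesgue (B \<inter> {x..2 * x}) = emeasure lborel (B \<inter> {x..2 * x})" for x by simp
  moreover assume "\<not> ?thesis"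
  ultimately have F_lim: "((\<lambda>\<delta>. ennreal \<delta> * F \<delta>) \<longlongrightarrow> 0) (at_right 0)"
    unfolding F_def by (intro not_omega_inverse_at_0) simp
  obtain K where K: "0 < K" "\<forall>\<^sub>F T in at_top. norm (LINT x:{T..2 * T} \<inter> B|lebesgue. (\<Delta> x)\<^sup>2 / x powr (2 * \<sigma>\<^sub>0 + 1)) \<le> K * norm (h T)"
    using landau_o.bigE[OF h] by blast
  then obtain T\<^sub>0 where T\<^sub>0: "\<And>T. T\<^sub>0 \<le> T \<Longrightarrow>
      norm (LINT x:{T..2 * T} \<inter> B|lebesgue. (\<Delta> x)\<^sup>2 / x powr (2 * \<sigma>\<^sub>0 + 1)) \<le> K * norm (h T)"
    unfolding eventually_at_top_linorder by blast
  define T\<^sub>1 where "T\<^sub>1 = max 1 T\<^sub>0"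
  have T\<^sub>1: "1 \<le> T\<^sub>1" by (simp add: T\<^sub>1_def)
  have mean_sq: "(\<integral>\<^sup>+u\<in>{x..2 * x} \<inter> B. ennreal ((\<Delta> u)\<^sup>2 / u powr (2 * \<sigma>\<^sub>0 + 1)) \<partial>lborel) \<le> ennreal (K * h x)"
    if "T\<^sub>1 \<le> x" for x
  proof -
    have x: "1 \<le> x" "T\<^sub>0 \<le> x" using that by (simp_all add: T\<^sub>1_def)
    have "(LINT u:{x..2 * x} \<inter> B|lebesgue. (\<Delta> u)\<^sup>2 / u powr (2 * \<sigma>\<^sub>0 + 1)) \<le> K * h x"
      using T\<^sub>0[OF x(2)] h_pos[OF x(1)] by (simp add: abs_le_iff)
    thus ?thesis using \<sigma>\<^sub>0(1) x(1) by (simp add: mean_square_window[OF B_meas] ennreal_leI)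
  qed
  define C where "C = (\<integral>\<^sup>+u\<in>{1..2 * T\<^sub>1}. ennreal (\<bar>\<Delta> u\<bar> * u powr (- \<sigma>\<^sub>0 - 1)) \<partial>lborel)"
  have C_fin: "C < \<infinity>"
  proof -
    obtain M where M: "0 \<le> M" "\<forall>x\<in>{1..2 * T\<^sub>1}. \<bar>\<Delta> x\<bar> \<le> M" using locally_bounded_of_growth by blast
    have "\<bar>\<Delta> u\<bar> * u powr (- \<sigma>\<^sub>0 - 1) \<le> M" if "u \<in> {1..2 * T\<^sub>1}" for u
    proof -
      have "u powr (- \<sigma>\<^sub>0 - 1) \<le> u powr 0" using that \<sigma>\<^sub>0 by (intro powr_mono) auto
      hence "\<bar>\<Delta> u\<bar> * u powr (- \<sigma>\<^sub>0 - 1) \<le> M * 1" using M that by (intro mult_mono) auto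
      thus ?thesis by simp
    qed
    hence "C \<le> (\<integral>\<^sup>+u. ennreal M * indicator {1..2 * T\<^sub>1} u \<partial>lborel)"
      unfolding C_def by (intro nn_integral_mono) (auto simp: indicator_def intro!: ennreal_leI)
    also have "\<dots> < \<infinity>" using T\<^sub>1 by (simp add: nn_integral_cmult_indicator ennreal_mult_less_top)
    finally show ?thesis .
  qed
  have P_le: "P \<delta> \<le> C + ennreal (1 / ln 2) * (ennreal (\<eta> / (2 * \<delta>)) + ennreal (K / (2 * \<eta>)) * F \<delta>)"
    if "0 < \<delta>" "0 < \<eta>" for \<delta> \<eta>
  proof -
    have "P \<delta> \<le> (\<integral>\<^sup>+u\<in>B. ennreal (\<Delta> u * u powr (- (\<sigma>\<^sub>0 + \<delta>) - 1)) \<partial>lborel)"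
      unfolding P_def
    proof (rule nn_integral_mono)
      fix x :: real
      show "ennreal ((\<Delta> x - c * x powr \<sigma>\<^sub>0) * x powr (- (\<sigma>\<^sub>0 + \<delta>) - 1)) * indicator {1..} x
          \<le> ennreal (\<Delta> x * x powr (- (\<sigma>\<^sub>0 + \<delta>) - 1)) * indicator B x"
      proof (cases "x \<in> B")
        case True
        thus ?thesis using c(1) by (auto simp: B intro!: ennreal_leI mult_right_mono)
      next
        case False
        thus ?thesis by (auto simp: B indicator_def ennreal_neg mult_nonpos_nonneg)
      qed
    qed
    also have "\<dots> \<le> C + ennreal (1 / ln 2) * (ennreal (\<eta> / (2 * \<delta>)) + ennreal (K / (2 * \<eta>)) * F \<delta>)"
      unfolding C_def F_def
      by (rule excess_integral_bound[OF \<Delta>_meas B_meas _ h_meas h_pos K(1) T\<^sub>1 that(2,1) mean_sq]) (auto simp: B)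
    finally show ?thesis .
  qed
  have "((\<lambda>\<delta>. ennreal \<delta> * P \<delta>) \<longlongrightarrow> 0) (at_right 0)"
  proof (rule order_tendstoI)
    fix y :: ennreal assume "0 < y"
    then obtain z where z: "0 < z" "z < y" using dense by blast
    then obtain e where e: "0 < e" "ennreal e < y"
      by (cases z) (auto simp: ennreal_less_zero_iff)
    \<comment> \<open>With this \<open>\<eta>\<close> the limit of the bound is \<open>e / 2\<close>.\<close>
    define \<eta> where "\<eta> = e * ln 2"
    have \<eta>: "0 < \<eta>" using e by (simp add: \<eta>_def)
    have "((\<lambda>\<delta>. C * ennreal \<delta> + ennreal (1 / ln 2) * (ennreal (\<eta> / 2) + ennreal (K / (2 * \<eta>)) * (ennreal \<delta> * F \<delta>)))
        \<longlongrightarrow> C * ennreal 0 + ennreal (1 / ln 2) * (ennreal (\<eta> / 2) + ennreal (K / (2 * \<eta>)) * 0)) (at_right 0)"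
      using C_fin by (intro tendsto_intros ennreal_tendsto_cmult F_lim) auto
    also have "C * ennreal 0 + ennreal (1 / ln 2) * (ennreal (\<eta> / 2) + ennreal (K / (2 * \<eta>)) * 0) = ennreal (e / 2)"
      using e by (simp add: \<eta>_def flip: ennreal_mult)
    finally have "\<forall>\<^sub>F \<delta> in at_right 0. C * ennreal \<delta> + ennreal (1 / ln 2) * (ennreal (\<eta> / 2) + ennreal (K / (2 * \<eta>)) * (ennreal \<delta> * F \<delta>)) < ennreal e"
      by (rule order_tendstoD) (use e in \<open>simp add: ennreal_lessI\<close>)
    thus "\<forall>\<^sub>F \<delta> in at_right 0. ennreal \<delta> * P \<delta> < y"
      using eventually_at_right_less[of 0]
    proof eventually_elim
      case (elim \<delta>)
      have "ennreal \<delta> * P \<delta> \<le> ennreal \<delta> * (C + ennreal (1 / ln 2) * (ennreal (\<eta> / (2 * \<delta>)) + ennreal (K / (2 * \<eta>)) * F \<delta>))"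
        using P_le[OF elim(2) \<eta>] by (rule mult_left_mono) simp
      also have "\<dots> = C * ennreal \<delta> + ennreal (1 / ln 2) * (ennreal \<delta> * ennreal (\<eta> / (2 * \<delta>)) + ennreal (K / (2 * \<eta>)) * (ennreal \<delta> * F \<delta>))"
        by (simp only: distrib_left mult_ac)
      also have "ennreal \<delta> * ennreal (\<eta> / (2 * \<delta>)) = ennreal (\<eta> / 2)"
        using elim(2) \<eta> by (simp flip: ennreal_mult)
      finally show ?case using elim(1) e(2) by (blast intro: order_le_less_trans order_less_trans)
    qed
  qed simp
  thus False
    using mellin_excess_not_negligible[OF \<Delta>_meas set_integrable_of_growth A \<sigma>\<^sub>0(2) half_line t\<^sub>0 lam l c(2)] \<sigma>\<^sub>0
    by (simp add: P_def)
qed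

end

theorem theorem11:
  fixes a :: "nat \<Rightarrow> real" and D A :: "complex \<Rightarrow> complex" and R :: "complex set"
    and \<sigma>\<^sub>0 \<sigma>\<^sub>1 \<sigma>\<^sub>2 t\<^sub>0 lam l\<^sub>s l\<^sub>i \<epsilon> :: real
    and \<Delta> h\<^sub>1 h\<^sub>2 :: "real \<Rightarrow> real" and \<A>\<^sub>1 \<A>\<^sub>2 :: "real set"
  assumes sigma: "0 < \<sigma>\<^sub>0" "\<sigma>\<^sub>0 < \<sigma>\<^sub>1" "\<sigma>\<^sub>1 < \<sigma>\<^sub>2"
    and abs_conv: "\<And>s. \<sigma>\<^sub>2 < Re s \<Longrightarrow> (\<lambda>n. norm (dirichlet_term a s n)) summable_on {1..}"
    and D_series: "\<And>s. \<sigma>\<^sub>2 < Re s \<Longrightarrow> D s = infsum (dirichlet_term a s) {1..}"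
    and D_mero: "D meromorphic_on {s. \<sigma>\<^sub>1 < Re s}"
    and D_poles: "finite (poles_right_of D \<sigma>\<^sub>1)" "\<And>\<rho>. \<rho> \<in> poles_right_of D \<sigma>\<^sub>1 \<Longrightarrow> Re \<rho> \<le> \<sigma>\<^sub>2"
    and Delta: "\<Delta> = error_term a D \<sigma>\<^sub>1"
    and A_cont: "continues_in_half_plane \<sigma>\<^sub>0 \<sigma>\<^sub>2 (error_mellin \<Delta>) A R"
    and L1: "t\<^sub>0 \<noteq> 0" "\<forall>\<^sub>F \<sigma> in at_right \<sigma>\<^sub>0. Complex \<sigma> t\<^sub>0 \<in> R"
      "Limsup (at_right \<sigma>\<^sub>0) (\<lambda>\<sigma>. ereal ((\<sigma> - \<sigma>\<^sub>0) * norm (A (Complex \<sigma> t\<^sub>0)))) = ereal lam"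
      "lam > 0"
    and L2: "Limsup (at_right \<sigma>\<^sub>0) (\<lambda>\<sigma>. ereal ((\<sigma> - \<sigma>\<^sub>0) * Re (A (of_real \<sigma>)))) = ereal l\<^sub>s"
      "Liminf (at_right \<sigma>\<^sub>0) (\<lambda>\<sigma>. ereal ((\<sigma> - \<sigma>\<^sub>0) * Re (A (of_real \<sigma>)))) = ereal l\<^sub>i"
    and L3: "l\<^sub>i + lam > 0" "l\<^sub>s - lam < 0"
    and L4: "\<And>\<sigma>. \<sigma>\<^sub>0 < \<sigma> \<Longrightarrow> of_real \<sigma> \<in> R"
    and eps: "0 < \<epsilon>" "\<epsilon> < min (l\<^sub>i + lam) (lam - l\<^sub>s)"
    and A1: "\<A>\<^sub>1 = {x \<in> {1..}. \<Delta> x > (l\<^sub>i + lam - \<epsilon>) * x powr \<sigma>\<^sub>0}"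
    and A2: "\<A>\<^sub>2 = {x \<in> {1..}. \<Delta> x < (l\<^sub>s - lam + \<epsilon>) * x powr \<sigma>\<^sub>0}"
    and h_meas: "h\<^sub>1 \<in> borel_measurable (lebesgue_on {1..})" "h\<^sub>2 \<in> borel_measurable (lebesgue_on {1..})"
    and h_pos: "\<And>T. T \<ge> 1 \<Longrightarrow> h\<^sub>1 T > 0" "\<And>T. T \<ge> 1 \<Longrightarrow> h\<^sub>2 T > 0"
    and h1: "(\<lambda>T. LINT x:{T..2*T} \<inter> \<A>\<^sub>1|lebesgue. (\<Delta> x)\<^sup>2 / x powr (2 * \<sigma>\<^sub>0 + 1)) \<in> O[at_top](h\<^sub>1)"
    and h2: "(\<lambda>T. LINT x:{T..2*T} \<inter> \<A>\<^sub>2|lebesgue. (\<Delta> x)\<^sup>2 / x powr (2 * \<sigma>\<^sub>0 + 1)) \<in> O[at_top](h\<^sub>2)"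
  shows "omega_inverse_at_0 (\<lambda>\<delta>. \<integral>\<^sup>+x\<in>{1..}.
             emeasure lebesgue (\<A>\<^sub>1 \<inter> {x..2*x}) * ennreal (h\<^sub>1 x / x powr (2 + \<delta>)) \<partial>lebesgue)
       \<and> omega_inverse_at_0 (\<lambda>\<delta>. \<integral>\<^sup>+x\<in>{1..}.
             emeasure lebesgue (\<A>\<^sub>2 \<inter> {x..2*x}) * ennreal (h\<^sub>2 x / x powr (2 + \<delta>)) \<partial>lebesgue)"
proof
  \<comment> \<open>Measurability on the whole line needs the values of \<open>\<Delta>\<close> below 1 cut off; the Mellin transform and the sets do not change.\<close>
  define \<Delta>\<^sub>1 where "\<Delta>\<^sub>1 = (\<lambda>x. indicator {1..} x * \<Delta> x)"
  have \<Delta>\<^sub>1_eq: "\<Delta>\<^sub>1 x = \<Delta> x" if "1 \<le> x" for x using that by (simp add: \<Delta>\<^sub>1_def)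
  have "0 < \<sigma>\<^sub>1" using sigma by simp
  note err = D_mero this D_poles(2)
  have meas: "\<Delta>\<^sub>1 \<in> borel_measurable borel"
    unfolding \<Delta>\<^sub>1_def Delta by (rule error_term_measurable[OF err])
  have growth: "\<exists>C. \<forall>x\<ge>1. \<bar>\<Delta>\<^sub>1 x\<bar> \<le> C * x powr \<sigma>" if "\<sigma>\<^sub>2 < \<sigma>" "0 \<le> \<sigma>" for \<sigma>
    using error_term_bound[OF err that abs_conv[of "of_real \<sigma>"]] that(1)
    by (simp add: \<Delta>\<^sub>1_eq flip: Delta)
  have mellin: "error_mellin \<Delta>\<^sub>1 = error_mellin \<Delta>"
    unfolding error_mellin_def set_lebesgue_integral_def
    by (intro ext Bochner_Integration.integral_cong refl) (auto simp: indicator_def \<Delta>\<^sub>1_def)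
  have \<sigma>\<^sub>02: "\<sigma>\<^sub>0 < \<sigma>\<^sub>2" using sigma by simp
  have window: "(LINT x:{T..2*T} \<inter> B|lebesgue. (\<Delta> x)\<^sup>2 / x powr (2 * \<sigma>\<^sub>0 + 1))
      = (LINT x:{T..2*T} \<inter> B|lebesgue. (\<Delta>\<^sub>1 x)\<^sup>2 / x powr (2 * \<sigma>\<^sub>0 + 1))" if "B \<subseteq> {1..}" for T B
    unfolding set_lebesgue_integral_def using that
    by (intro Bochner_Integration.integral_cong refl) (auto simp: indicator_def \<Delta>\<^sub>1_def)
  show "omega_inverse_at_0 (\<lambda>\<delta>. \<integral>\<^sup>+x\<in>{1..}.
      emeasure lebesgue (\<A>\<^sub>1 \<inter> {x..2*x}) * ennreal (h\<^sub>1 x / x powr (2 + \<delta>)) \<partial>lebesgue)"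
  proof (rule excess_set_omega[OF meas growth _ sigma(1) \<sigma>\<^sub>02 L4 L1(1,2,3) L2(2)])
    show "continues_in_half_plane \<sigma>\<^sub>0 \<sigma>\<^sub>2 (error_mellin \<Delta>\<^sub>1) A R" using A_cont by (simp only: mellin)
    show "0 \<le> l\<^sub>i + lam - \<epsilon>" "l\<^sub>i + lam - \<epsilon> < l\<^sub>i + lam" using eps by auto
    show "\<A>\<^sub>1 = {x \<in> {1..}. \<Delta>\<^sub>1 x > (l\<^sub>i + lam - \<epsilon>) * x powr \<sigma>\<^sub>0}"
      unfolding A1 by (auto simp: \<Delta>\<^sub>1_eq)
    have "\<A>\<^sub>1 \<subseteq> {1..}" by (auto simp: A1)
    from h1[unfolded window[OF this]]
    show "(\<lambda>T. LINT x:{T..2*T} \<inter> \<A>\<^sub>1|lebesgue. (\<Delta>\<^sub>1 x)\<^sup>2 / x powr (2 * \<sigma>\<^sub>0 + 1)) \<in> O[at_top](h\<^sub>1)" .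
  qed (use h_meas h_pos in auto)
  \<comment> \<open>The second set is the first one for \<open>- \<Delta>\<close>: then \<open>A\<close> changes its sign, \<open>lam\<close> stays, and \<open>- l\<^sub>s\<close> takes the place of \<open>l\<^sub>i\<close>.\<close>
  have meas': "(\<lambda>x. - \<Delta>\<^sub>1 x) \<in> borel_measurable borel" using meas by simp
  have growth': "\<exists>C. \<forall>x\<ge>1. \<bar>- \<Delta>\<^sub>1 x\<bar> \<le> C * x powr \<sigma>" if "\<sigma>\<^sub>2 < \<sigma>" "0 \<le> \<sigma>" for \<sigma>
    using growth[OF that] by simp
  have mellin': "error_mellin (\<lambda>x. - \<Delta>\<^sub>1 x) = (\<lambda>s. - error_mellin \<Delta> s)"
    unfolding mellin[symmetric] error_mellin_def set_lebesgue_integral_def by (intro ext) simp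
  show "omega_inverse_at_0 (\<lambda>\<delta>. \<integral>\<^sup>+x\<in>{1..}.
      emeasure lebesgue (\<A>\<^sub>2 \<inter> {x..2*x}) * ennreal (h\<^sub>2 x / x powr (2 + \<delta>)) \<partial>lebesgue)"
  proof (rule excess_set_omega[OF meas' growth' _ sigma(1) \<sigma>\<^sub>02 L4 L1(1,2)])
    show "continues_in_half_plane \<sigma>\<^sub>0 \<sigma>\<^sub>2 (error_mellin (\<lambda>x. - \<Delta>\<^sub>1 x)) (\<lambda>s. - A s) R"
      using A_cont unfolding continues_in_half_plane_def mellin' by (auto intro!: holomorphic_intros)
    show "Limsup (at_right \<sigma>\<^sub>0) (\<lambda>\<sigma>. ereal ((\<sigma> - \<sigma>\<^sub>0) * norm (- A (Complex \<sigma> t\<^sub>0)))) = ereal lam"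
      using L1(3) by simp
    show "Liminf (at_right \<sigma>\<^sub>0) (\<lambda>\<sigma>. ereal ((\<sigma> - \<sigma>\<^sub>0) * Re (- A (of_real \<sigma>)))) = ereal (- l\<^sub>s)"
      using ereal_Liminf_uminus[of "at_right \<sigma>\<^sub>0" "\<lambda>\<sigma>. ereal ((\<sigma> - \<sigma>\<^sub>0) * Re (A (of_real \<sigma>)))"] L2(1) by simp
    show "0 \<le> lam - l\<^sub>s - \<epsilon>" "lam - l\<^sub>s - \<epsilon> < - l\<^sub>s + lam" using eps by auto
    show "\<A>\<^sub>2 = {x \<in> {1..}. - \<Delta>\<^sub>1 x > (lam - l\<^sub>s - \<epsilon>) * x powr \<sigma>\<^sub>0}"
      unfolding A2 by (auto simp: \<Delta>\<^sub>1_eq algebra_simps)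
    have "\<A>\<^sub>2 \<subseteq> {1..}" by (auto simp: A2)
    from h2[unfolded window[OF this]]
    show "(\<lambda>T. LINT x:{T..2*T} \<inter> \<A>\<^sub>2|lebesgue. (- \<Delta>\<^sub>1 x)\<^sup>2 / x powr (2 * \<sigma>\<^sub>0 + 1)) \<in> O[at_top](h\<^sub>2)" by simp
  qed (use h_meas h_pos in auto)
qed

end
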